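(* Consider the linear-quadratic sensorimotor (LQS) control problem of minimizing $$J=\mathrm{E}\Big\{x_N^{\mathrm T}Q_Nx_N+\sum_{t=0}^{N-1}\big(x_t^{\mathrm T}Qx_t+u_t^{\mathrm T}Ru_t\big)\Big\}$$ subject to $$x_{t+1}=Ax_t+Bu_t+\xi_t+\sum_{i=1}^{c}\varepsilon_t^{(i)}C_iu_t,\qquad y_t=Hx_t+\omega_t+\sum_{i=1}^{d}\epsilon_t^{(i)}D_ix_t .$$ Let its (approximate) solution be given by the control law $u_t=-L_t\hat x_t$ and the estimator $\hat x_{t+1}=A\hat x_t+Bu_t+K_t(y_t-H\hat x_t)+\eta_t$, initialized with $\hat x_0=\mathrm{E}\{x_0\}$, with the control matrices $L_t$ and filter matrices $K_t$ $$L_t=\Big(R+B^{\mathrm T}Z_{t+1}^{x}B+\sum_iC_i^{\mathrm T}(Z_{t+1}^{x}+Z_{t+1}^{e})C_i\Big)^{-1}B^{\mathrm T}Z_{t+1}^{x}A,$$ $$K_t=AP_t^{e}H^{\mathrm T}\Big(HP_t^{e}H^{\mathrm T}+\Omega^{\omega}+\sum_iD_i\big(P_t^{e}+P_t^{\hat x}+P_t^{\hat xe}+P_t^{e\hat x}\big)D_i^{\mathrm T}\Big)^{-1}$$ obtained by the iteration described in the context. Then the mean $\mathrm{E}\{x_t\}$ and the covariance $\Omega_t^x=\mathrm{cov}(x_t)$ of $x_t$ are computed, for $t=0,\dots,N-1$, by the recursions $$\begin{bmatrix}\mathrm{E}\{x_{t+1}\}\\ \mathrm{E}\{\hat x_{t+1}\}\end{bmatrix}=\mathcal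 A_t\begin{bmatrix}\mathrm{E}\{x_t\}\\ \mathrm{E}\{\hat x_t\}\end{bmatrix},$$ $$\begin{bmatrix}\Omega_{t+1}^{x}&\Omega_{t+1}^{x\hat x}\\ \Omega_{t+1}^{\hat xx}&\Omega_{t+1}^{\hat x}\end{bmatrix}=\mathcal A_t\begin{bmatrix}\Omega_{t}^{x}&\Omega_{t}^{x\hat x}\\ \Omega_{t}^{\hat xx}&\Omega_{t}^{\hat x}\end{bmatrix}\mathcal A_t^{\mathrm T}+\begin{bmatrix}\Omega^{\xi}&0\\ 0&\Omega^{\eta}+K_t\Omega^{\omega}K_t^{\mathrm T}\end{bmatrix}+\begin{bmatrix}\bar\Omega_t^{\hat x}&0\\ 0&\bar\Omega_t^{x}\end{bmatrix},$$ where $\Omega_t^{x\hat x}=\mathrm{cov}(x_t,\hat x_t)$, $\Omega_t^{\hat xx}=\mathrm{cov}(\hat x_t,x_t)$, $\Omega_t^{\hat x}=\mathrm{cov}(\hat x_t)$, $$\bar\Omega_t^{\hat x}=\sum_iC_iL_t\big(\Omega_t^{\hat x}+\mathrm{E}\{\hat x_t\}\mathrm{E}\{\hat x_t\}^{\mathrm T}\big)L_t^{\mathrm T}C_i^{\mathrm T},\qquad \bar\Omega_t^{x}=\sum_iK_tD_i\big(\Omega_t^{x}+\mathrm{E}\{x_t\}\mathrm{E}\{x_t\}^{\mathrm T}\big)D_i^{\mathrm T}K_t^{\mathrm T},$$ $$\mathcal A_t=\begin{bmatrix}A&-BL_t\\ K_tH&A-K_tH-BL_t\end{bmatrix},$$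 with initial values $\mathrm{E}\{\hat x_0\}=\hat x_0=\mathrm{E}\{x_0\}$ and $$\begin{bmatrix}\Omega_{0}^{x}&\Omega_{0}^{x\hat x}\\ \Omega_{0}^{\hat xx}&\Omega_{0}^{\hat x}\end{bmatrix}=\begin{bmatrix}\Omega_0^x&0\\ 0&0\end{bmatrix}.$$
   Context: Time is discrete, $t=0,1,\dots,N$. $x_t\in\mathbb R^n$ is the (random) system state, $u_t\in\mathbb R^m$ the control, $y_t\in\mathbb R^r$ the observed output, $\hat x_t\in\mathbb R^n$ the state estimate. $A,B,H$ are real matrices of appropriate dimensions; they may depend on time $t$ (the time index is suppressed). The time-independent matrices $C_i$ ($i=1,\dots,c$) and $D_i$ ($i=1,\dots,d$) have the form $C_i=\sigma_i^{u}BF_i$ and $D_i=\sigma_i^{x}HG_i$ with real scalars $\sigma_i^u,\sigma_i^x$ and matrices $F_i,G_i$ of appropriate dimensions. Sums over $i$ involving $C_i$ run over $1,\dots,c$, those involving $D_i$ over $1,\dots,d$. For random vectors $a,b$: $\mathrm{cov}(a,b)=\mathrm{E}\{(a-\mathrm{E}\{a\})(b-\mathrm{E}\{b\})^{\mathrm T}\}$ and $\mathrm{cov}(a)=\mathrm{cov}(a,a)$. Noise: $\xi_t=\Sigma^{\xi}\alpha_t$ and $\omega_t=\Sigma^{\omega}\beta_t$, where $\alpha_t,\beta_t$ are standard white Gaussian noise processes (zero mean, identity covariance, independent across time) and $\Sigma^\xi,\Sigma^\omega$ are constant matrices; $\Omega^\xi=\mathrm{cov}(\xi_t)=\Sigma^\xi(\Sigma^\xi)^{\mathrm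 T}$ (positive semi-definite) and $\Omega^\omega=\mathrm{cov}(\omega_t)=\Sigma^\omega(\Sigma^\omega)^{\mathrm T}$, assumed positive definite. $\varepsilon_t=(\varepsilon_t^{(1)},\dots,\varepsilon_t^{(c)})^{\mathrm T}$ and $\epsilon_t=(\epsilon_t^{(1)},\dots,\epsilon_t^{(d)})^{\mathrm T}$ are two (different) standard white Gaussian noise processes with $\mathrm{cov}(\varepsilon_t)=I$, $\mathrm{cov}(\epsilon_t)=I$. $\eta_t\in\mathbb R^n$ is a zero-mean white Gaussian noise process with symmetric positive semi-definite covariance $\Omega^\eta$. All these noise processes are independent of each other and of the state, in the usual sense that $x_0$ and all $\xi_s,\omega_s,\varepsilon_s,\epsilon_s,\eta_s$ ($s\ge0$) are mutually independent (so the noises at time $t$ are independent of the current pair $(x_t,\hat x_t)$). The mean $\mathrm{E}\{x_0\}$ and the covariance $\Omega_0^x=\mathrm{cov}(x_0)$ (positive semi-definite) are given. Cost matrices: $Q_N,Q,R$ are symmetric, $Q_N,Q$ positive semi-definite, $R$ positive definite. Gains (Todorov's iterative approximate solution): starting from an initial choice of deterministic matrices $K_0,\dots,K_{N-1}$, one alternates between (i) computing all $L_t$ from the current $K_t$ and (ii) computing all $K_t$ from the current $L_t$, by the displayed formulas for $L_t$ and $K_t$; $L_t$ and $K_t$ in the claim are the deterministic matrices resulting from this iteration (the inverses appearing are taken to exist). The auxiliary matrices are given by the following recursions. Step (i), backward in $t$, with $Z_N^x=Q_N$, $Z_N^e=0$: $$Z_t^x=Q+A^{\mathrm T}Z_{t+1}^x(A-BL_t)+\sum_iD_i^{\mathrm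 T}K_t^{\mathrm T}Z_{t+1}^eK_tD_i,$$ $$Z_t^e=A^{\mathrm T}Z_{t+1}^xBL_t+(A-K_tH)^{\mathrm T}Z_{t+1}^e(A-K_tH).$$ Step (ii), forward in $t$, with $P_0^e=\Omega_0^x$, $P_0^{\hat x}=\hat x_0\hat x_0^{\mathrm T}$, $P_0^{\hat xe}=0$ and $P_t^{e\hat x}=(P_t^{\hat xe})^{\mathrm T}$: $$P_{t+1}^e=\Omega^\xi+\Omega^\eta+(A-K_tH)P_t^eA^{\mathrm T}+\sum_iC_iL_tP_t^{\hat x}L_t^{\mathrm T}C_i^{\mathrm T},$$ $$P_{t+1}^{\hat x}=\Omega^\eta+K_tHP_t^eA^{\mathrm T}+(A-BL_t)P_t^{\hat x}(A-BL_t)^{\mathrm T}+(A-BL_t)P_t^{\hat xe}H^{\mathrm T}K_t^{\mathrm T}+K_tHP_t^{e\hat x}(A-BL_t)^{\mathrm T},$$ $$P_{t+1}^{\hat xe}=(A-BL_t)P_t^{\hat xe}(A-K_tH)^{\mathrm T}-\Omega^\eta.$$ *)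

theory Defs
  imports "HOL-Probability.Probability"
begin

definition pos_semidef :: "real ^ 'n ^ 'n \<Rightarrow> bool" where
  "pos_semidef S \<longleftrightarrow> transpose S = S \<and> (\<forall>v. 0 \<le> v \<bullet> (S *v v))"

definition pos_def :: "real ^ 'n ^ 'n \<Rightarrow> bool" where
  "pos_def S \<longleftrightarrow> transpose S = S \<and> (\<forall>v. v \<noteq> 0 \<longrightarrow> 0 < v \<bullet> (S *v v))"

definition outer :: "real ^ 'n \<Rightarrow> real ^ 'm \<Rightarrow> real ^ 'm ^ 'n" where
  "outer a b = (\<chi> i j. a $ i * b $ j)"

definition block_vec :: "real ^ 'n \<Rightarrow> real ^ 'm \<Rightarrow> real ^ ('n + 'm)" where
  "block_vec a b = (\<chi> i. case i of Inl k \<Rightarrow> a $ k | Inr k \<Rightarrow> b $ k)"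

definition block_mat ::
  "real ^ 'p ^ 'n \<Rightarrow> real ^ 'q ^ 'n \<Rightarrow> real ^ 'p ^ 'm \<Rightarrow> real ^ 'q ^ 'm \<Rightarrow> real ^ ('p + 'q) ^ ('n + 'm)" where
  "block_mat S T U V =
     (\<chi> i. case i of Inl k \<Rightarrow> block_vec (S $ k) (T $ k) | Inr k \<Rightarrow> block_vec (U $ k) (V $ k))"

definition cov :: "'w measure \<Rightarrow> ('w \<Rightarrow> real ^ 'n) \<Rightarrow> ('w \<Rightarrow> real ^ 'm) \<Rightarrow> real ^ 'm ^ 'n" where
  "cov M a b = integral\<^sup>L M (\<lambda>w. outer (a w - integral\<^sup>L M a) (b w - integral\<^sup>L M b))"

text \<open>
  Bochner integrals of non-integrable functions are 0; on a probability space the following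
  condition guarantees that means and covariances are genuine.
\<close>

definition square_integrable_vec :: "'w measure \<Rightarrow> ('w \<Rightarrow> real ^ 'n) \<Rightarrow> bool" where
  "square_integrable_vec M X \<longleftrightarrow>
     X \<in> borel_measurable M \<and> integrable M (\<lambda>w. (norm (X w))\<^sup>2)"

text \<open>
  Covariances may be singular, so a Gaussian vector need not have a density: it is defined by
  requiring all its linear functionals to be normal, a variance of 0 meaning a constant.
\<close>

definition gaussian_rv :: "'w measure \<Rightarrow> ('w \<Rightarrow> real) \<Rightarrow> real \<Rightarrow> real \<Rightarrow> bool" where
  "gaussian_rv M X \<mu> v \<longleftrightarrow> X \<in> borel_measurable M \<and>
     (if v = 0 then AE w in M. X w = \<mu>
      else 0 < v \<and> distributed M lborel X (\<lambda>z. ennreal (normal_density \<mu> (sqrt v) z)))"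

definition gaussian_vec :: "'w measure \<Rightarrow> ('w \<Rightarrow> real ^ 'n) \<Rightarrow> real ^ 'n \<Rightarrow> real ^ 'n ^ 'n \<Rightarrow> bool" where
  "gaussian_vec M X \<mu> S \<longleftrightarrow> X \<in> borel_measurable M \<and>
     (\<forall>a. gaussian_rv M (\<lambda>w. a \<bullet> X w) (a \<bullet> \<mu>) (a \<bullet> (S *v a)))"

text \<open>Zero-mean white Gaussian noise with covariance \<open>S\<close>; it is standard if \<open>S = mat 1\<close>.\<close>

definition white_gaussian_noise ::
  "'w measure \<Rightarrow> (nat \<Rightarrow> 'w \<Rightarrow> real ^ 'n) \<Rightarrow> real ^ 'n ^ 'n \<Rightarrow> bool" where
  "white_gaussian_noise M X S \<longleftrightarrow>
     (\<forall>t. gaussian_vec M (X t) 0 S) \<and> prob_space.indep_vars M (\<lambda>_. borel) X UNIV"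

text \<open>
  Mutual independence of random vectors of different dimensions. The library's
  \<open>indep_vars\<close> wants a single value type, so the families of events generated by
  the vectors are used instead, exactly as in its definition.
\<close>

datatype source = InitialState | Xi nat | Omega nat | EpsU nat | EpsY nat | Eta nat

definition generated_events :: "'w measure \<Rightarrow> ('w \<Rightarrow> real ^ 'n) \<Rightarrow> 'w set set" where
  "generated_events M X = {X -` S \<inter> space M | S. S \<in> sets borel}"

definition independent_sources ::
  "'w measure \<Rightarrow> ('w \<Rightarrow> real ^ 'n) \<Rightarrow> (nat \<Rightarrow> 'w \<Rightarrow> real ^ 'n) \<Rightarrow> (nat \<Rightarrow> 'w \<Rightarrow> real ^ 'r) \<Rightarrow>
   (nat \<Rightarrow> 'w \<Rightarrow> real ^ 'c) \<Rightarrow> (nat \<Rightarrow> 'w \<Rightarrow> real ^ 'd) \<Rightarrow> (nat \<Rightarrow> 'w \<Rightarrow> real ^ 'n) \<Rightarrow> bool" where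
  "independent_sources M x0 \<xi> \<omega> \<epsilon>u \<epsilon>y \<eta> \<longleftrightarrow>
     prob_space.indep_sets M
       (\<lambda>s. case s of
          InitialState \<Rightarrow> generated_events M x0
        | Xi t \<Rightarrow> generated_events M (\<xi> t)
        | Omega t \<Rightarrow> generated_events M (\<omega> t)
        | EpsU t \<Rightarrow> generated_events M (\<epsilon>u t)
        | EpsY t \<Rightarrow> generated_events M (\<epsilon>y t)
        | Eta t \<Rightarrow> generated_events M (\<eta> t))
       UNIV"

text \<open>
  \<open>control_step N A B H C D QN Q R K L\<close>: the control matrices \<open>L\<close> result from the filter
  matrices \<open>K\<close> by the backward recursion, all inverses existing along the way.
\<close>

definition control_step ::
  "nat \<Rightarrow> (nat \<Rightarrow> real ^ 'n ^ 'n) \<Rightarrow> (nat \<Rightarrow> real ^ 'm ^ 'n) \<Rightarrow> (nat \<Rightarrow> real ^ 'n ^ 'r) \<Rightarrow>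
   ('c::finite \<Rightarrow> real ^ 'm ^ 'n) \<Rightarrow> ('d::finite \<Rightarrow> real ^ 'n ^ 'r) \<Rightarrow>
   real ^ 'n ^ 'n \<Rightarrow> real ^ 'n ^ 'n \<Rightarrow> real ^ 'm ^ 'm \<Rightarrow>
   (nat \<Rightarrow> real ^ 'r ^ 'n) \<Rightarrow> (nat \<Rightarrow> real ^ 'n ^ 'm) \<Rightarrow> bool" where
  "control_step N A B H C D QN Q R K L \<longleftrightarrow>
     (\<exists>Zx Ze. Zx N = QN \<and> Ze N = 0 \<and>
       (\<forall>t<N.
          let W = R + transpose (B t) ** Zx (Suc t) ** B t
                    + (\<Sum>i\<in>UNIV. transpose (C i) ** (Zx (Suc t) + Ze (Suc t)) ** C i)
          in invertible W \<and>
             L t = matrix_inv W ** transpose (B t) ** Zx (Suc t) ** A t \<and>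
             Zx t = Q + transpose (A t) ** Zx (Suc t) ** (A t - B t ** L t)
                    + (\<Sum>i\<in>UNIV. transpose (D i) ** transpose (K t) ** Ze (Suc t) ** K t ** D i) \<and>
             Ze t = transpose (A t) ** Zx (Suc t) ** B t ** L t
                    + transpose (A t - K t ** H t) ** Ze (Suc t) ** (A t - K t ** H t)))"

text \<open>
  \<open>filter_step N A B H C D \<Omega>\<xi> \<Omega>\<omega> \<Omega>\<eta> \<Omega>0 xh0 L K\<close>: the filter matrices \<open>K\<close> result from the control
  matrices \<open>L\<close> by the forward recursion. \<open>Ph\<close> and \<open>Phe\<close> are $P^{\hat x}$ and $P^{\hat x e}$.
\<close>

definition filter_step ::
  "nat \<Rightarrow> (nat \<Rightarrow> real ^ 'n ^ 'n) \<Rightarrow> (nat \<Rightarrow> real ^ 'm ^ 'n) \<Rightarrow> (nat \<Rightarrow> real ^ 'n ^ 'r) \<Rightarrow>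
   ('c::finite \<Rightarrow> real ^ 'm ^ 'n) \<Rightarrow> ('d::finite \<Rightarrow> real ^ 'n ^ 'r) \<Rightarrow>
   real ^ 'n ^ 'n \<Rightarrow> real ^ 'r ^ 'r \<Rightarrow> real ^ 'n ^ 'n \<Rightarrow> real ^ 'n ^ 'n \<Rightarrow> real ^ 'n \<Rightarrow>
   (nat \<Rightarrow> real ^ 'n ^ 'm) \<Rightarrow> (nat \<Rightarrow> real ^ 'r ^ 'n) \<Rightarrow> bool" where
  "filter_step N A B H C D \<Omega>\<xi> \<Omega>\<omega> \<Omega>\<eta> \<Omega>0 xh0 L K \<longleftrightarrow>
     (\<exists>Pe Ph Phe. Pe 0 = \<Omega>0 \<and> Ph 0 = outer xh0 xh0 \<and> Phe 0 = 0 \<and>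
       (\<forall>t<N.
          let V = H t ** Pe t ** transpose (H t) + \<Omega>\<omega>
                    + (\<Sum>i\<in>UNIV. D i ** (Pe t + Ph t + Phe t + transpose (Phe t)) ** transpose (D i));
              F = A t - B t ** L t
          in invertible V \<and>
             K t = A t ** Pe t ** transpose (H t) ** matrix_inv V \<and>
             Pe (Suc t) = \<Omega>\<xi> + \<Omega>\<eta> + (A t - K t ** H t) ** Pe t ** transpose (A t)
                    + (\<Sum>i\<in>UNIV. C i ** L t ** Ph t ** transpose (L t) ** transpose (C i)) \<and>
             Ph (Suc t) = \<Omega>\<eta> + K t ** H t ** Pe t ** transpose (A t)
                    + F ** Ph t ** transpose F
                    + F ** Phe t ** transpose (H t) ** transpose (K t)
                    + K t ** H t ** transpose (Phe t) ** transpose F \<and>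
             Phe (Suc t) = F ** Phe t ** transpose (A t - K t ** H t) - \<Omega>\<eta>))"

text \<open>
  The pairs \<open>(L, K)\<close> reached by alternating the two steps, from an arbitrary initial choice of
  filter matrices, such that each member has been computed at least once. The iteration may
  stop after either kind of step. A fixed point of the iteration is included, since it is
  reached when starting from its own filter matrices.
\<close>

inductive alternating_gains ::
  "('k \<Rightarrow> 'l \<Rightarrow> bool) \<Rightarrow> ('l \<Rightarrow> 'k \<Rightarrow> bool) \<Rightarrow> 'l \<Rightarrow> 'k \<Rightarrow> bool"
  for ctrl :: "'k \<Rightarrow> 'l \<Rightarrow> bool" and filt :: "'l \<Rightarrow> 'k \<Rightarrow> bool" where
  first_round: "ctrl K0 L \<Longrightarrow> filt L K \<Longrightarrow> alternating_gains ctrl filt L K"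
| control_update: "alternating_gains ctrl filt L K \<Longrightarrow> ctrl K L' \<Longrightarrow> alternating_gains ctrl filt L' K"
| filter_update: "alternating_gains ctrl filt L K \<Longrightarrow> filt L K' \<Longrightarrow> alternating_gains ctrl filt L K'"

definition closed_loop_mat ::
  "real ^ 'n ^ 'n \<Rightarrow> real ^ 'm ^ 'n \<Rightarrow> real ^ 'n ^ 'r \<Rightarrow> real ^ 'n ^ 'm \<Rightarrow> real ^ 'r ^ 'n \<Rightarrow>
   real ^ ('n + 'n) ^ ('n + 'n)" where
  "closed_loop_mat A B H L K = block_mat A (- (B ** L)) (K ** H) (A - K ** H - B ** L)"

definition joint_cov ::
  "'w measure \<Rightarrow> ('w \<Rightarrow> real ^ 'n) \<Rightarrow> ('w \<Rightarrow> real ^ 'm) \<Rightarrow> real ^ ('n + 'm) ^ ('n + 'm)" where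
  "joint_cov M a b = block_mat (cov M a a) (cov M a b) (cov M b a) (cov M b b)"

definition lqs_cost ::
  "'w measure \<Rightarrow> nat \<Rightarrow> real ^ 'n ^ 'n \<Rightarrow> real ^ 'n ^ 'n \<Rightarrow> real ^ 'm ^ 'm \<Rightarrow>
   (nat \<Rightarrow> 'w \<Rightarrow> real ^ 'n) \<Rightarrow> (nat \<Rightarrow> 'w \<Rightarrow> real ^ 'm) \<Rightarrow> real" where
  "lqs_cost M N QN Q R x u =
     integral\<^sup>L M (\<lambda>w. x N w \<bullet> (QN *v x N w)
       + (\<Sum>t<N. x t w \<bullet> (Q *v x t w) + u t w \<bullet> (R *v u t w)))"

end

theory Submission
  imports Defs
begin

text \<open>
  Stack the state and its estimate into one vector \<open>s\<close>. Substituting the control law and the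
  output into the dynamics gives a recursion \<open>s' = T s + (\<Sum>k. \<nu>\<^sub>k g\<^sub>k)\<close>, where \<open>T\<close> is the
  closed-loop matrix, \<open>\<nu>\<close> stacks all noise acting in the current step, and the gains \<open>g\<^sub>k\<close> are
  constant for the additive noises and linear in the current \<open>x\<close> or \<open>xh\<close> for the multiplicative
  ones (\<open>closed_loop_step\<close>).

  The vector \<open>s\<close> and the gains are functions of the initial state and of earlier noise, hence
  independent of \<open>\<nu>\<close>. Since \<open>\<nu>\<close> has mean zero, it leaves the mean recursion
  unchanged, and all cross terms between \<open>s\<close> and \<open>\<nu>\<close> drop out of the covariance. What remains is
  \<open>cov s' = T (cov s) T\<^sup>T + (\<Sum>k l. E(\<nu>\<^sub>k \<nu>\<^sub>l) E(g\<^sub>k g\<^sub>l\<^sup>T))\<close> (\<open>noise_driven_step\<close>).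

  The different noise processes are uncorrelated, so the double sum is a sum over processes
  (\<open>noise_gain_second_moments\<close>): \<open>\<xi>\<close>, \<open>\<omega>\<close> and \<open>\<eta>\<close> give the constant covariance terms, and the
  multiplicative noises give the second moments \<open>E(xh xh\<^sup>T)\<close> and \<open>E(x x\<^sup>T)\<close>, each of which is a
  covariance plus the outer product of a mean with itself.

  The independence of past and present is derived by letting disjoint groups of noise sources
  generate sigma-algebras (\<open>indep_set_sigma_disjoint_sources\<close>); the second moments of the noise
  come from its Gaussian linear functionals (\<open>gaussian_vec_centred_with_cov\<close>).
\<close>

section \<open>Block vectors, block matrices and outer products\<close>

lemma sum_UNIV_Plus:
  fixes f :: "'a::finite + 'b::finite \<Rightarrow> 'c::comm_monoid_add"
  shows "sum f UNIV = (\<Sum>i\<in>UNIV. f (Inl i)) + (\<Sum>j\<in>UNIV. f (Inr j))"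
  by (simp add: UNIV_Plus_UNIV[symmetric] sum.Plus del: UNIV_Plus_UNIV)

lemma outer_nth [simp]: "outer a b $ i $ j = a $ i * b $ j"
  by (simp add: outer_def)

lemma block_vec_nth [simp]:
  "block_vec a b $ Inl i = a $ i"
  "block_vec a b $ Inr j = b $ j"
  by (simp_all add: block_vec_def)

lemma block_mat_nth [simp]:
  "block_mat S T U V $ Inl i = block_vec (S $ i) (T $ i)"
  "block_mat S T U V $ Inr j = block_vec (U $ j) (V $ j)"
  by (simp_all add: block_mat_def)

lemma block_vec_eqI:
  assumes "\<And>i. v $ Inl i = w $ Inl i" "\<And>j. v $ Inr j = w $ Inr j"
  shows "v = w"
  by (metis assms sum.exhaust vec_eq_iff)

lemma block_mat_mult_vec:
  "block_mat S T U V *v block_vec a b = block_vec (S *v a + T *v b) (U *v a + V *v b)"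
  by (rule block_vec_eqI) (simp_all add: matrix_vector_mult_def sum_UNIV_Plus)

lemma block_mat_add:
  "block_mat S T U V + block_mat S' T' U' V' = block_mat (S + S') (T + T') (U + U') (V + V')"
  by (rule block_vec_eqI; rule block_vec_eqI) simp_all

lemma block_mat_zero: "block_mat 0 0 0 0 = 0"
  by (rule block_vec_eqI; rule block_vec_eqI) simp_all

lemma sum_block_mat:
  "(\<Sum>i\<in>I. block_mat (S i) (T i) (U i) (V i))
    = block_mat (\<Sum>i\<in>I. S i) (\<Sum>i\<in>I. T i) (\<Sum>i\<in>I. U i) (\<Sum>i\<in>I. V i)"
  by (rule block_vec_eqI; rule block_vec_eqI) simp_all

lemma outer_block_vec:
  "outer (block_vec a b) (block_vec c d) = block_mat (outer a c) (outer a d) (outer b c) (outer b d)"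
  by (rule block_vec_eqI; rule block_vec_eqI) simp_all

lemma outer_zero [simp]: "outer 0 b = 0" "outer a 0 = 0"
  by (simp_all add: vec_eq_iff)

lemma transpose_outer: "transpose (outer a b) = outer b a"
  by (simp add: vec_eq_iff transpose_def)

lemma outer_matrix_vector_mult:
  "outer (S *v a) (T *v b) = S ** outer a b ** transpose T"
  by (simp add: vec_eq_iff matrix_vector_mult_def matrix_matrix_mult_def transpose_def
        sum_distrib_left sum_distrib_right mult_ac)

text \<open>
  A noise vector with covariance \<open>S\<close> that passes through \<open>U\<close> is a sum of its coordinates times the
  columns of \<open>U\<close>. With \<open>U\<close> the identity or the filter matrix, this produces the additive
  covariance terms.
\<close>

lemma outer_sum_scaleR_columns:
  fixes S :: "real ^ 'k ^ 'k" and U :: "real ^ 'k ^ 'n"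
  shows "(\<Sum>k\<in>UNIV. \<Sum>l\<in>UNIV. S $ k $ l *\<^sub>R outer (column k U) (column l U)) = U ** S ** transpose U"
proof -
  have "(\<Sum>k\<in>UNIV. \<Sum>l\<in>UNIV. U $ i $ k * (U $ j $ l * S $ k $ l))
      = (\<Sum>l\<in>UNIV. \<Sum>k\<in>UNIV. U $ i $ k * (U $ j $ l * S $ k $ l))" for i j
    by (rule sum.swap)
  then show ?thesis
    by (simp add: vec_eq_iff matrix_matrix_mult_def transpose_def column_def
        sum_distrib_left sum_distrib_right mult_ac)
qed

lemma matrix_vector_mult_columns:
  fixes U :: "real ^ 'k ^ 'n"
  shows "(\<Sum>k\<in>UNIV. v $ k *\<^sub>R column k U) = U *v v"
  by (simp add: vec_eq_iff matrix_vector_mult_def column_def mult_ac)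

lemma sum_mat_1_scaleR:
  fixes X :: "'k::finite \<Rightarrow> 'k \<Rightarrow> 'b::real_vector"
  shows "(\<Sum>k\<in>UNIV. \<Sum>l\<in>UNIV. (mat 1 :: real ^ 'k ^ 'k) $ k $ l *\<^sub>R X k l) = (\<Sum>k\<in>UNIV. X k k)"
proof -
  have "(\<Sum>l\<in>UNIV. (mat 1 :: real ^ 'k ^ 'k) $ k $ l *\<^sub>R X k l) = X k k" for k
  proof -
    have "(\<Sum>l\<in>UNIV. (mat 1 :: real ^ 'k ^ 'k) $ k $ l *\<^sub>R X k l) = (\<Sum>l\<in>UNIV. if k = l then X k l else 0)"
      by (intro sum.cong) (auto simp: mat_def)
    then show ?thesis by simp
  qed
  then show ?thesis by simp
qed

lemma bounded_bilinear_outer: "bounded_bilinear (outer :: real ^ 'n \<Rightarrow> real ^ 'm \<Rightarrow> real ^ 'm ^ 'n)"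
proof (rule bilinear_conv_bounded_bilinear[THEN iffD1])
  show "bilinear (outer :: real ^ 'n \<Rightarrow> real ^ 'm \<Rightarrow> real ^ 'm ^ 'n)"
    by (auto simp: bilinear_def linear_iff vec_eq_iff algebra_simps)
qed

lemma bounded_linear_transpose: "bounded_linear (transpose :: real ^ 'n ^ 'm \<Rightarrow> _)"
  by (rule linear_linear[THEN iffD2]) (auto simp: linear_iff vec_eq_iff transpose_def)

lemma bounded_linear_matrix_mult_both:
  fixes S :: "real ^ 'k ^ 'n" and T :: "real ^ 'm ^ 'l"
  shows "bounded_linear (\<lambda>X. S ** X ** T)"
proof (rule linear_linear[THEN iffD2], rule linearI)
  fix X Y :: "real ^ 'l ^ 'k" and c :: real
  show "S ** (X + Y) ** T = S ** X ** T + S ** Y ** T"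
    by (simp add: vec_eq_iff matrix_matrix_mult_def distrib_left distrib_right sum.distrib)
  show "S ** (c *\<^sub>R X) ** T = c *\<^sub>R (S ** X ** T)"
    by (simp add: vec_eq_iff matrix_matrix_mult_def sum_distrib_left sum_distrib_right mult_ac)
qed

lemma bounded_linear_block_vec_left: "bounded_linear (\<lambda>a :: real ^ 'n. block_vec a (0 :: real ^ 'm))"
  by (rule linear_linear[THEN iffD2])
    (auto simp: linear_iff intro!: block_vec_eqI)

lemma bounded_linear_block_vec_right: "bounded_linear (\<lambda>b :: real ^ 'm. block_vec (0 :: real ^ 'n) b)"
  by (rule linear_linear[THEN iffD2])
    (auto simp: linear_iff intro!: block_vec_eqI)

lemma block_vec_split: "block_vec a b = block_vec a 0 + block_vec 0 b"
  by (auto intro!: block_vec_eqI)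

section \<open>Square-integrable random vectors\<close>

lemma square_integrable_vec_add:
  assumes "square_integrable_vec M X" "square_integrable_vec M Y"
  shows "square_integrable_vec M (\<lambda>w. X w + Y w)"
proof -
  have [measurable]: "X \<in> borel_measurable M" "Y \<in> borel_measurable M"
    and i: "integrable M (\<lambda>w. (norm (X w))\<^sup>2)" "integrable M (\<lambda>w. (norm (Y w))\<^sup>2)"
    using assms by (auto simp: square_integrable_vec_def)
  have "(norm (X w + Y w))\<^sup>2 \<le> 2 * (norm (X w))\<^sup>2 + 2 * (norm (Y w))\<^sup>2" for w
  proof -
    have "(norm (X w + Y w))\<^sup>2 \<le> (norm (X w) + norm (Y w))\<^sup>2"
      by (intro power_mono norm_triangle_ineq) simp
    also have "\<dots> \<le> 2 * (norm (X w))\<^sup>2 + 2 * (norm (Y w))\<^sup>2"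
      using zero_le_power2[of "norm (X w) - norm (Y w)"] by (simp add: power2_eq_square algebra_simps)
    finally show ?thesis .
  qed
  then have "integrable M (\<lambda>w. (norm (X w + Y w))\<^sup>2)"
    using i by (intro Bochner_Integration.integrable_bound[where g="\<lambda>w. (norm (X w + Y w))\<^sup>2"
        and f = "\<lambda>w. 2 * (norm (X w))\<^sup>2 + 2 * (norm (Y w))\<^sup>2"]) auto
  then show ?thesis by (simp add: square_integrable_vec_def)
qed

lemma square_integrable_vec_bounded_linear:
  assumes "square_integrable_vec M X" "bounded_linear f"
  shows "square_integrable_vec M (\<lambda>w. f (X w))"
proof -
  interpret bounded_linear f by fact
  have [measurable]: "X \<in> borel_measurable M" and i: "integrable M (\<lambda>w. (norm (X w))\<^sup>2)"
    using assms by (auto simp: square_integrable_vec_def)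
  have m: "(\<lambda>w. f (X w)) \<in> borel_measurable M"
    by (rule borel_measurable_continuous_on[OF linear_continuous_on[OF assms(2)]]) fact
  obtain k where k: "\<And>x. norm (f x) \<le> norm x * k" using bounded by blast
  have "(norm (f (X w)))\<^sup>2 \<le> k\<^sup>2 * (norm (X w))\<^sup>2" for w
    using power_mono[OF k[of "X w"], of 2] by (simp add: power_mult_distrib mult.commute)
  then have "integrable M (\<lambda>w. (norm (f (X w)))\<^sup>2)"
    using i m by (intro Bochner_Integration.integrable_bound[where g="\<lambda>w. (norm (f (X w)))\<^sup>2"
        and f = "\<lambda>w. k\<^sup>2 * (norm (X w))\<^sup>2"]) auto
  then show ?thesis using m by (simp add: square_integrable_vec_def)
qed

lemma square_integrable_vec_zero: "square_integrable_vec M (\<lambda>w. 0)"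
  by (simp add: square_integrable_vec_def)

lemma square_integrable_vec_sum:
  assumes "\<And>i. i \<in> I \<Longrightarrow> square_integrable_vec M (X i)"
  shows "square_integrable_vec M (\<lambda>w. \<Sum>i\<in>I. X i w)"
  using assms
  by (induction I rule: infinite_finite_induct)
    (auto intro: square_integrable_vec_zero square_integrable_vec_add)

lemma square_integrable_vec_cong:
  assumes "\<And>w. w \<in> space M \<Longrightarrow> X w = Y w"
  shows "square_integrable_vec M X \<longleftrightarrow> square_integrable_vec M Y"
  unfolding square_integrable_vec_def
  using assms by (intro conj_cong measurable_cong Bochner_Integration.integrable_cong) auto

lemma square_integrable_vec_block_vec:
  assumes "square_integrable_vec M X" "square_integrable_vec M Y"
  shows "square_integrable_vec M (\<lambda>w. block_vec (X w) (Y w))"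
  by (subst block_vec_split)
    (intro square_integrable_vec_add
       square_integrable_vec_bounded_linear[OF assms(1) bounded_linear_block_vec_left]
       square_integrable_vec_bounded_linear[OF assms(2) bounded_linear_block_vec_right])

lemma (in finite_measure) square_integrable_vec_const: "square_integrable_vec M (\<lambda>w. c)"
  by (simp add: square_integrable_vec_def)

lemma (in finite_measure) integrable_if_square_integrable_vec:
  assumes "square_integrable_vec M X"
  shows "integrable M X"
proof -
  have [measurable]: "X \<in> borel_measurable M" and i: "integrable M (\<lambda>w. (norm (X w))\<^sup>2)"
    using assms by (auto simp: square_integrable_vec_def)
  have "norm (X w) \<le> norm (1 + (norm (X w))\<^sup>2)" for w
  proof -
    have "0 \<le> (norm (X w) - 1)\<^sup>2" by simp
    then have "2 * norm (X w) \<le> 1 + (norm (X w))\<^sup>2" by (simp add: power2_diff)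
    then have "norm (X w) \<le> 1 + (norm (X w))\<^sup>2" using norm_ge_zero[of "X w"] by linarith
    then show ?thesis by simp
  qed
  then show ?thesis
    using i by (intro Bochner_Integration.integrable_bound[where g=X
        and f = "\<lambda>w. 1 + (norm (X w))\<^sup>2"]) auto
qed

lemma integrable_outer:
  fixes X :: "'w \<Rightarrow> real ^ 'n" and Y :: "'w \<Rightarrow> real ^ 'm"
  assumes "square_integrable_vec M X" "square_integrable_vec M Y"
  shows "integrable M (\<lambda>w. outer (X w) (Y w))"
proof -
  have [measurable]: "X \<in> borel_measurable M" "Y \<in> borel_measurable M"
    and i: "integrable M (\<lambda>w. (norm (X w))\<^sup>2)" "integrable M (\<lambda>w. (norm (Y w))\<^sup>2)"
    using assms by (auto simp: square_integrable_vec_def)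
  interpret bounded_bilinear "outer :: real ^ 'n \<Rightarrow> real ^ 'm \<Rightarrow> real ^ 'm ^ 'n"
    by (rule bounded_bilinear_outer)
  obtain k where k: "0 \<le> k" "\<And>a b. norm (outer a b :: real ^ 'm ^ 'n) \<le> norm a * norm b * k"
    using nonneg_bounded by blast
  have m: "(\<lambda>w. outer (X w) (Y w)) \<in> borel_measurable M"
    by (rule borel_measurable_continuous_Pair[OF \<open>X \<in> borel_measurable M\<close> \<open>Y \<in> borel_measurable M\<close>])
      (intro bounded_bilinear.continuous_on[OF bounded_bilinear_outer] continuous_on_fst continuous_on_snd
        continuous_on_id)
  have "norm (outer (X w) (Y w)) \<le> norm (k * ((norm (X w))\<^sup>2 + (norm (Y w))\<^sup>2))" for w
  proof -
    have "norm (X w) * norm (Y w) \<le> (norm (X w))\<^sup>2 + (norm (Y w))\<^sup>2"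
      using sum_squares_bound[of "norm (X w)" "norm (Y w)"]
        mult_nonneg_nonneg[OF norm_ge_zero[of "X w"] norm_ge_zero[of "Y w"]] by linarith
    from mult_right_mono[OF this k(1)] k(2)[of "X w" "Y w"] show ?thesis
      using k(1) by (simp add: mult.commute)
  qed
  then show ?thesis
    using i m by (intro Bochner_Integration.integrable_bound[where g="\<lambda>w. outer (X w) (Y w)"
        and f = "\<lambda>w. k * ((norm (X w))\<^sup>2 + (norm (Y w))\<^sup>2)"]) auto
qed

lemma integral_vec_nth:
  fixes X :: "'w \<Rightarrow> ('b::euclidean_space) ^ 'n"
  assumes "integrable M X"
  shows "integral\<^sup>L M X $ i = (\<integral>w. X w $ i \<partial>M)"
  using integral_bounded_linear[OF bounded_linear_vec_nth assms] by simp

lemma integral_mat_nth: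
  fixes X :: "'w \<Rightarrow> real ^ 'm ^ 'n"
  assumes "integrable M X"
  shows "integral\<^sup>L M X $ i $ j = (\<integral>w. X w $ i $ j \<partial>M)"
  using integral_vec_nth[OF assms, of i]
    integral_vec_nth[OF integrable_bounded_linear[OF bounded_linear_vec_nth assms], of i j] by simp

lemma integrable_block_vec:
  assumes "integrable M X" "integrable M Y"
  shows "integrable M (\<lambda>w. block_vec (X w) (Y w))"
  by (subst block_vec_split)
    (intro Bochner_Integration.integrable_add
       integrable_bounded_linear[OF bounded_linear_block_vec_left assms(1)]
       integrable_bounded_linear[OF bounded_linear_block_vec_right assms(2)])

lemma integral_block_vec:
  assumes "integrable M X" "integrable M Y"
  shows "(\<integral>w. block_vec (X w) (Y w) \<partial>M) = block_vec (integral\<^sup>L M X) (integral\<^sup>L M Y)"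
  by (rule block_vec_eqI) (simp_all add: integral_vec_nth integrable_block_vec assms)

lemma integral_outer_block_vec:
  assumes "square_integrable_vec M X" "square_integrable_vec M Y"
    "square_integrable_vec M X'" "square_integrable_vec M Y'"
  shows "(\<integral>w. outer (block_vec (X w) (Y w)) (block_vec (X' w) (Y' w)) \<partial>M)
    = block_mat (\<integral>w. outer (X w) (X' w) \<partial>M) (\<integral>w. outer (X w) (Y' w) \<partial>M)
        (\<integral>w. outer (Y w) (X' w) \<partial>M) (\<integral>w. outer (Y w) (Y' w) \<partial>M)"
  by (rule block_vec_eqI; rule block_vec_eqI)
    (simp_all add: integral_mat_nth integrable_outer square_integrable_vec_block_vec assms)

text \<open>
  This turns the coupled recursion for the covariances of the state and its estimate into the
  recursion for the covariance of one stacked vector.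
\<close>

lemma (in prob_space) joint_cov_eq_cov_block_vec:
  assumes "square_integrable_vec M X" "square_integrable_vec M Y"
  shows "joint_cov M X Y = cov M (\<lambda>w. block_vec (X w) (Y w)) (\<lambda>w. block_vec (X w) (Y w))"
proof -
  have c: "square_integrable_vec M (\<lambda>w. Z w - c)" if "square_integrable_vec M Z" for Z :: "'a \<Rightarrow> real ^ 'k" and c
    using square_integrable_vec_add[OF that square_integrable_vec_const, of "- c"] by simp
  have d: "block_vec a b - block_vec a' b' = block_vec (a - a') (b - b')"
    for a a' :: "real ^ 'k" and b b' :: "real ^ 'l"
    by (rule block_vec_eqI) simp_all
  show ?thesis
    by (simp add: cov_def joint_cov_def integral_block_vec integrable_if_square_integrable_vec assms d
      integral_outer_block_vec c)
qed

lemma (in prob_space) integral_outer_eq_cov: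
  assumes "square_integrable_vec M X"  "square_integrable_vec M Y"
  shows "(\<integral>w. outer (X w) (Y w) \<partial>M) = cov M X Y + outer (integral\<^sup>L M X) (integral\<^sup>L M Y)"
proof -
  define m n where "m = integral\<^sup>L M X" and "n = integral\<^sup>L M Y"
  interpret o: bounded_bilinear outer by (rule bounded_bilinear_outer)
  have i: "integrable M (\<lambda>w. outer (X w) (Y w))" "integrable M X" "integrable M Y"
    using assms by (auto intro: integrable_outer integrable_if_square_integrable_vec)
  have "cov M X Y = (\<integral>w. outer (X w) (Y w) - outer (X w) n - outer m (Y w) + outer m n \<partial>M)"
    by (simp add: cov_def m_def[symmetric] n_def[symmetric] o.diff_left o.diff_right algebra_simps)
  also have "\<dots> = (\<integral>w. outer (X w) (Y w) \<partial>M) - outer m n - outer m n + outer m n"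
    using i integral_bounded_linear[OF o.bounded_linear_left i(2), of n]
       integral_bounded_linear[OF o.bounded_linear_right i(3), of m]
       integrable_bounded_linear[OF o.bounded_linear_left i(2), of n]
       integrable_bounded_linear[OF o.bounded_linear_right i(3), of m]
    by (simp add: m_def[symmetric] n_def[symmetric] prob_space)
  finally show ?thesis by (simp add: m_def n_def)
qed

section \<open>One step of a linear recursion driven by independent noise\<close>

lemma borel_measurable_vec_nth:
  fixes X :: "'w \<Rightarrow> real ^ 'n"
  assumes "X \<in> borel_measurable F"
  shows "(\<lambda>w. X w $ i) \<in> borel_measurable F"
  by (rule borel_measurable_continuous_on[OF linear_continuous_on[OF bounded_linear_vec_nth] assms])

context prob_space
begin

lemma indep_var_if_indep_subalgebras:
  assumes "subalgebra M F" "subalgebra M G" "indep_set (sets F) (sets G)"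
    and "X \<in> borel_measurable F" "Y \<in> borel_measurable G"
  shows "indep_var borel X borel Y"
proof -
  have sp: "space F = space M" "space G = space M"
    using assms(1,2) by (auto simp: subalgebra_def)
  have "random_variable borel X" "random_variable borel Y"
    using assms by (auto intro: measurable_from_subalg)
  moreover have "sigma_sets (space M) {X -` S \<inter> space M |S. S \<in> sets borel} \<subseteq> sets F"
  proof -
    have "{X -` S \<inter> space M |S. S \<in> sets borel} \<subseteq> sets F"
      using measurable_sets[OF assms(4)] sp by auto
    from sets.sigma_sets_subset[OF this] show ?thesis by (simp add: sp)
  qed
  moreover have "sigma_sets (space M) {Y -` S \<inter> space M |S. S \<in> sets borel} \<subseteq> sets G"
  proof -
    have "{Y -` S \<inter> space M |S. S \<in> sets borel} \<subseteq> sets G"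
      using measurable_sets[OF assms(5)] sp by auto
    from sets.sigma_sets_subset[OF this] show ?thesis by (simp add: sp)
  qed
  ultimately show ?thesis
    unfolding indep_var_eq indep_set_def
    by (intro conjI indep_sets_mono_sets[OF assms(3)[unfolded indep_set_def]])
      (simp_all split: bool.split)
qed

text \<open>
  Each coordinate of the product is a product of two independent real variables. Stating the
  result for an arbitrary Euclidean space covers both random vectors and random matrices.
\<close>

lemma expectation_scaleR_indep:
  fixes Y :: "'a \<Rightarrow> 'b::euclidean_space"
  assumes alg: "subalgebra M F" "subalgebra M G" "indep_set (sets F) (sets G)"
    and X: "X \<in> borel_measurable F" "integrable M X"
    and Y: "Y \<in> borel_measurable G" "integrable M Y"
  shows "integrable M (\<lambda>w. X w *\<^sub>R Y w)"
    and "expectation (\<lambda>w. X w *\<^sub>R Y w) = expectation X *\<^sub>R expectation Y"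
proof -
  have Yb: "(\<lambda>w. Y w \<bullet> b) \<in> borel_measurable G" "integrable M (\<lambda>w. Y w \<bullet> b)" for b
    using Y by auto
  note iv = indep_var_if_indep_subalgebras[OF alg X(1) Yb(1)]
  have b: "integrable M (\<lambda>w. X w * (Y w \<bullet> b))"
    "expectation (\<lambda>w. X w * (Y w \<bullet> b)) = expectation X * expectation (\<lambda>w. Y w \<bullet> b)" for b
    using indep_var_integrable[OF iv X(2) Yb(2)] indep_var_lebesgue_integral[OF iv X(2) Yb(2)] by auto
  have e: "X w *\<^sub>R Y w = (\<Sum>b\<in>Basis. (X w * (Y w \<bullet> b)) *\<^sub>R b)" for w
    by (subst euclidean_representation[of "Y w", symmetric]) (simp add: scaleR_sum_right)
  show i: "integrable M (\<lambda>w. X w *\<^sub>R Y w)"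
    unfolding e using b by (intro Bochner_Integration.integrable_sum integrable_scaleR_left) auto
  show "expectation (\<lambda>w. X w *\<^sub>R Y w) = expectation X *\<^sub>R expectation Y"
  proof (rule euclidean_eqI)
    fix c :: 'b
    have "expectation (\<lambda>w. X w *\<^sub>R Y w) \<bullet> c = expectation (\<lambda>w. X w * (Y w \<bullet> c))"
      using integral_inner_left[of c M "\<lambda>w. X w *\<^sub>R Y w"] i by simp
    also have "\<dots> = (expectation X *\<^sub>R expectation Y) \<bullet> c"
      using b(2)[of c] integral_inner_left[of c M Y] Y(2) by simp
    finally show "expectation (\<lambda>w. X w *\<^sub>R Y w) \<bullet> c = (expectation X *\<^sub>R expectation Y) \<bullet> c" .
  qed
qed

lemma expectation_outer_indep:
  fixes X :: "'a \<Rightarrow> real ^ 'n" and Y :: "'a \<Rightarrow> real ^ 'm"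
  assumes alg: "subalgebra M F" "subalgebra M G" "indep_set (sets F) (sets G)"
    and X: "X \<in> borel_measurable F" "square_integrable_vec M X"
    and Y: "Y \<in> borel_measurable G" "square_integrable_vec M Y"
  shows "expectation (\<lambda>w. outer (X w) (Y w)) = outer (expectation X) (expectation Y)"
proof -
  have i: "integrable M X" "integrable M Y"
    using X Y by (auto intro: integrable_if_square_integrable_vec)
  have "expectation (\<lambda>w. X w $ i * Y w $ j) = expectation (\<lambda>w. X w $ i) * expectation (\<lambda>w. Y w $ j)" for i j
    using X(1) Y(1) i integrable_bounded_linear[OF bounded_linear_vec_nth i(1)]
      integrable_bounded_linear[OF bounded_linear_vec_nth i(2)]
    by (intro indep_var_lebesgue_integral indep_var_if_indep_subalgebras[OF alg] borel_measurable_vec_nth)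
      auto
  then show ?thesis
    using i by (simp add: vec_eq_iff integral_mat_nth integrable_outer X Y) (simp add: integral_vec_nth)
qed

text \<open>
  The gains \<open>g\<close> are random because the noise may multiply the state, but they are known before
  the noise is drawn: they are measurable with respect to \<open>G\<close>, which is independent of the
  noise. Hence every term that is linear in the noise has the factor \<open>expectation \<nu> = 0\<close> and
  vanishes. Of the expanded outer product of the centred next state only the propagated old
  covariance and the terms quadratic in the noise survive, and in the latter the second moments
  of the noise and of the gains separate. Independence is also what makes the products of two
  square-integrable factors square-integrable again.
\<close>

lemma noise_driven_step:
  fixes s s' :: "'a \<Rightarrow> real ^ 'n" and \<nu> :: "'a \<Rightarrow> real ^ 'k" and g :: "'k \<Rightarrow> 'a \<Rightarrow> real ^ 'n"
  assumes alg: "subalgebra M F" "subalgebra M G" "indep_set (sets F) (sets G)"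
    and \<nu>: "\<nu> \<in> borel_measurable F" "square_integrable_vec M \<nu>" "expectation \<nu> = 0"
    and s: "s \<in> borel_measurable G" "square_integrable_vec M s"
    and g: "\<And>k. g k \<in> borel_measurable G" "\<And>k. square_integrable_vec M (g k)"
    and step: "\<And>w. w \<in> space M \<Longrightarrow> s' w = T *v s w + (\<Sum>k\<in>UNIV. \<nu> w $ k *\<^sub>R g k w)"
  shows "square_integrable_vec M s'"
    and "expectation s' = T *v expectation s"
    and "cov M s' s' = T ** cov M s s ** transpose T
      + (\<Sum>k\<in>UNIV. \<Sum>l\<in>UNIV. expectation (\<lambda>w. outer (\<nu> w) (\<nu> w)) $ k $ l
           *\<^sub>R expectation (\<lambda>w. outer (g k w) (g l w)))"
proof -
  define m where "m = expectation s"
  define d where "d w = T *v (s w - m)" for w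
  interpret o: bounded_bilinear "outer :: real ^ 'n \<Rightarrow> real ^ 'n \<Rightarrow> _" by (rule bounded_bilinear_outer)
  have linT: "bounded_linear ((*v) T)" by simp
  have s_i: "integrable M s" using s by (simp add: integrable_if_square_integrable_vec)
  have d: "d \<in> borel_measurable G" "square_integrable_vec M d"
  proof -
    show "d \<in> borel_measurable G"
      unfolding d_def using s(1)
      by (intro borel_measurable_continuous_on[OF linear_continuous_on[OF linT]]) auto
    show "square_integrable_vec M d"
      unfolding d_def
      using square_integrable_vec_add[OF s(2) square_integrable_vec_const, of "- m"]
      by (intro square_integrable_vec_bounded_linear[OF _ linT]) simp
  qed
  have \<nu>_i: "integrable M \<nu>" using \<nu> by (simp add: integrable_if_square_integrable_vec)
  have \<nu>k: "(\<lambda>w. \<nu> w $ k) \<in> borel_measurable F" "integrable M (\<lambda>w. \<nu> w $ k)"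
      "expectation (\<lambda>w. \<nu> w $ k) = 0" for k
    using borel_measurable_vec_nth[OF \<nu>(1)] \<nu>(3) integrable_bounded_linear[OF bounded_linear_vec_nth \<nu>_i]
      integral_vec_nth[OF \<nu>_i, of k] by auto
  have \<nu>kl: "(\<lambda>w. \<nu> w $ k * \<nu> w $ l) \<in> borel_measurable F" "integrable M (\<lambda>w. \<nu> w $ k * \<nu> w $ l)"
      "expectation (\<lambda>w. \<nu> w $ k * \<nu> w $ l) = expectation (\<lambda>w. outer (\<nu> w) (\<nu> w)) $ k $ l" for k l
    using \<nu>k(1)[of k] \<nu>k(1)[of l] integrable_outer[OF \<nu>(2) \<nu>(2)]
      integrable_bounded_linear[OF bounded_linear_vec_nth[of l]
         integrable_bounded_linear[OF bounded_linear_vec_nth[of k] integrable_outer[OF \<nu>(2) \<nu>(2)]]]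
    by (auto simp: integral_mat_nth)
  have outer_meas: "(\<lambda>w. outer (a w) (b w)) \<in> borel_measurable G"
    if "a \<in> borel_measurable G" "b \<in> borel_measurable G" for a b :: "'a \<Rightarrow> real ^ 'n"
    by (rule borel_measurable_continuous_Pair[OF that])
      (intro bounded_bilinear.continuous_on[OF bounded_bilinear_outer] continuous_on_fst continuous_on_snd
        continuous_on_id)
  note g_i = integrable_if_square_integrable_vec[OF g(2)]
  note Eg = expectation_scaleR_indep[OF alg \<nu>k(1,2) g(1) g_i, unfolded \<nu>k(3) scale_zero_left]
  note Edg = expectation_scaleR_indep[OF alg \<nu>k(1,2) outer_meas[OF d(1) g(1)]
      integrable_outer[OF d(2) g(2)], unfolded \<nu>k(3) scale_zero_left]
  note Egd = expectation_scaleR_indep[OF alg \<nu>k(1,2) outer_meas[OF g(1) d(1)]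
      integrable_outer[OF g(2) d(2)], unfolded \<nu>k(3) scale_zero_left]
  note Egg = expectation_scaleR_indep[OF alg \<nu>kl(1,2) outer_meas[OF g(1) g(1)]
      integrable_outer[OF g(2) g(2)], unfolded \<nu>kl(3)]
  have g_sq: "square_integrable_vec M (\<lambda>w. \<nu> w $ k *\<^sub>R g k w)" for k
  proof -
    have "(\<lambda>w. \<nu> w $ k *\<^sub>R g k w) \<in> borel_measurable M"
      using Eg(1) by auto
    moreover have "(\<lambda>w. (norm (g k w))\<^sup>2) \<in> borel_measurable G" "integrable M (\<lambda>w. (norm (g k w))\<^sup>2)"
      using g[of k] by (auto simp: square_integrable_vec_def)
    from expectation_scaleR_indep(1)[OF alg \<nu>kl(1)[of k k] \<nu>kl(2)[of k k] this]
    have "integrable M (\<lambda>w. (norm (\<nu> w $ k *\<^sub>R g k w))\<^sup>2)"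
      by (simp add: power_mult_distrib flip: power2_eq_square)
    ultimately show ?thesis by (simp add: square_integrable_vec_def)
  qed
  have "square_integrable_vec M (\<lambda>w. T *v s w + (\<Sum>k\<in>UNIV. \<nu> w $ k *\<^sub>R g k w))"
    by (intro square_integrable_vec_add square_integrable_vec_sum g_sq
      square_integrable_vec_bounded_linear[OF s(2) linT])
  then show "square_integrable_vec M s'"
    using step by (subst square_integrable_vec_cong) auto
  have "expectation s' = expectation (\<lambda>w. T *v s w + (\<Sum>k\<in>UNIV. \<nu> w $ k *\<^sub>R g k w))"
    using step by (intro Bochner_Integration.integral_cong) auto
  also have "\<dots> = T *v m"
    unfolding m_def using Eg integral_bounded_linear[OF linT s_i] integrable_bounded_linear[OF linT s_i]
    by (subst Bochner_Integration.integral_add) (auto simp: Bochner_Integration.integral_sum)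
  finally show mean: "expectation s' = T *v expectation s" by (simp add: m_def)
  \<comment> \<open>\<open>d\<close> carries the centred old state and \<open>?n\<close> the noise; only \<open>d d\<^sup>T\<close> and \<open>?n ?n\<^sup>T\<close>
    can have a nonzero expectation.\<close>
  let ?n = "\<lambda>w. \<Sum>k\<in>UNIV. \<nu> w $ k *\<^sub>R g k w"
  have s'_centred: "s' w - expectation s' = d w + ?n w" if "w \<in> space M" for w
    using step[OF that] by (simp add: mean d_def m_def matrix_vector_mult_diff_distrib)
  have dn: "outer (d w) (?n w) = (\<Sum>k\<in>UNIV. \<nu> w $ k *\<^sub>R outer (d w) (g k w))" for w
    by (simp add: o.sum_right o.scaleR_right)
  have nd: "outer (?n w) (d w) = (\<Sum>k\<in>UNIV. \<nu> w $ k *\<^sub>R outer (g k w) (d w))" for w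
    by (simp add: o.sum_left o.scaleR_left)
  have nn: "outer (?n w) (?n w) = (\<Sum>k\<in>UNIV. \<Sum>l\<in>UNIV. (\<nu> w $ k * \<nu> w $ l) *\<^sub>R outer (g k w) (g l w))" for w
    by (subst o.sum_left) (simp add: o.sum_right o.scaleR_left o.scaleR_right scaleR_sum_right mult.commute)
  have "cov M s' s' = expectation (\<lambda>w. outer (d w) (d w)
      + (outer (d w) (?n w) + (outer (?n w) (d w) + outer (?n w) (?n w))))"
    unfolding cov_def
    by (intro Bochner_Integration.integral_cong refl)
      (simp add: s'_centred o.add_left o.add_right add_ac)
  also have "\<dots> = expectation (\<lambda>w. outer (d w) (d w)
      + ((\<Sum>k\<in>UNIV. \<nu> w $ k *\<^sub>R outer (d w) (g k w)) + ((\<Sum>k\<in>UNIV. \<nu> w $ k *\<^sub>R outer (g k w) (d w))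
      + (\<Sum>k\<in>UNIV. \<Sum>l\<in>UNIV. (\<nu> w $ k * \<nu> w $ l) *\<^sub>R outer (g k w) (g l w)))))"
    unfolding dn nd nn ..
  also have "\<dots> = expectation (\<lambda>w. outer (d w) (d w))
      + (\<Sum>k\<in>UNIV. \<Sum>l\<in>UNIV. expectation (\<lambda>w. outer (\<nu> w) (\<nu> w)) $ k $ l
           *\<^sub>R expectation (\<lambda>w. outer (g k w) (g l w)))"
    by (simp add: Bochner_Integration.integral_add Bochner_Integration.integral_sum
        Edg Egd Egg integrable_outer d)
  also have "expectation (\<lambda>w. outer (d w) (d w)) = T ** cov M s s ** transpose T"
  proof -
    have "square_integrable_vec M (\<lambda>w. s w - m)"
      using square_integrable_vec_add[OF s(2) square_integrable_vec_const, of "- m"] by simp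
    from integral_bounded_linear[OF bounded_linear_matrix_mult_both integrable_outer[OF this this]]
    show ?thesis
      by (simp add: d_def outer_matrix_vector_mult cov_def m_def)
  qed
  finally show "cov M s' s' = T ** cov M s s ** transpose T
      + (\<Sum>k\<in>UNIV. \<Sum>l\<in>UNIV. expectation (\<lambda>w. outer (\<nu> w) (\<nu> w)) $ k $ l
           *\<^sub>R expectation (\<lambda>w. outer (g k w) (g l w)))" .
qed

end

section \<open>Gaussian vectors\<close>

lemma (in prob_space) gaussian_rv_moments:
  assumes "gaussian_rv M X 0 v"
  shows "integrable M X" "integrable M (\<lambda>w. (X w)\<^sup>2)" "expectation X = 0" "expectation (\<lambda>w. (X w)\<^sup>2) = v"
proof -
  have m [measurable]: "X \<in> borel_measurable M" using assms by (simp add: gaussian_rv_def)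
  have "integrable M X \<and> integrable M (\<lambda>w. (X w)\<^sup>2) \<and> expectation X = 0 \<and> expectation (\<lambda>w. (X w)\<^sup>2) = v"
  proof (cases "v = 0")
    case True
    with assms have ae: "AE w in M. X w = 0" by (simp add: gaussian_rv_def)
    then have ae2: "AE w in M. (X w)\<^sup>2 = 0" by auto
    show ?thesis
      using integrable_cong_AE[of X M "\<lambda>_. 0"] integrable_cong_AE[of "\<lambda>w. (X w)\<^sup>2" M "\<lambda>_. 0"]
        integral_cong_AE[of X M "\<lambda>_. 0"] integral_cong_AE[of "\<lambda>w. (X w)\<^sup>2" M "\<lambda>_. 0"] ae ae2 True
      by simp
  next
    case False
    with assms have v: "0 < v"
      and D: "distributed M lborel X (\<lambda>z. ennreal (normal_density 0 (sqrt v) z))"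
      by (auto simp: gaussian_rv_def)
    have sq: "0 < sqrt v" using v by simp
    have "integrable M X"
      using distributed_integrable[OF D, of "\<lambda>z. z"] integrable_normal_moment_nz_1[OF sq, of 0] by simp
    moreover have "integrable M (\<lambda>w. (X w)\<^sup>2)"
      using distributed_integrable[OF D, of "\<lambda>z. z\<^sup>2"] integrable_normal_moment[OF sq, of 0 2] by simp
    moreover have E: "expectation X = 0"
      using normal_distributed_expectation[OF sq D] .
    moreover have "expectation (\<lambda>w. (X w)\<^sup>2) = v"
      using normal_distributed_variance[OF sq D] v E by simp
    ultimately show ?thesis by simp
  qed
  then show "integrable M X" "integrable M (\<lambda>w. (X w)\<^sup>2)" "expectation X = 0" "expectation (\<lambda>w. (X w)\<^sup>2) = v"
    by auto
qed

text \<open>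
  For a vector of mean zero the second moment matrix is the covariance matrix. Square
  integrability is included because otherwise the Bochner integrals could be 0 by default.
\<close>

definition centred_with_cov :: "'w measure \<Rightarrow> ('w \<Rightarrow> real ^ 'n) \<Rightarrow> real ^ 'n ^ 'n \<Rightarrow> bool" where
  "centred_with_cov M X S \<longleftrightarrow> square_integrable_vec M X \<and> integral\<^sup>L M X = 0
    \<and> (\<integral>w. outer (X w) (X w) \<partial>M) = S"

text \<open>
  The definition of a Gaussian vector only gives the variances of its linear functionals, that
  is, the quadratic form of \<open>S\<close>. The mixed second moments follow by polarization with the
  functionals \<open>axis i 1 + axis j 1\<close>, which recovers \<open>S\<close> itself because \<open>S\<close> is symmetric.
\<close>

lemma (in prob_space) gaussian_vec_centred_with_cov:
  assumes g: "gaussian_vec M X 0 S" and sym: "transpose S = S"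
  shows "centred_with_cov M X S"
  unfolding centred_with_cov_def
proof (intro conjI)
  have m [measurable]: "X \<in> borel_measurable M"
    and a: "gaussian_rv M (\<lambda>w. a \<bullet> X w) 0 (a \<bullet> (S *v a))" for a
    using g by (auto simp: gaussian_vec_def)
  note mom = gaussian_rv_moments[OF a]
  have quad: "integrable M (\<lambda>w. (X w $ i)\<^sup>2)" for i
    using mom(2)[of "axis i 1"] by (simp add: inner_axis')
  show sq: "square_integrable_vec M X"
    unfolding square_integrable_vec_def
    using quad by (auto simp: power2_norm_eq_inner inner_vec_def simp flip: power2_eq_square)
  have i: "integrable M X" using sq by (rule integrable_if_square_integrable_vec)
  show "expectation X = 0"
    using mom(3)[of "axis i 1" for i] by (simp add: vec_eq_iff integral_vec_nth i inner_axis')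
  have io: "integrable M (\<lambda>w. X w $ i * X w $ j)" for i j
    using integrable_bounded_linear[OF bounded_linear_vec_nth[of j]
         integrable_bounded_linear[OF bounded_linear_vec_nth[of i] integrable_outer[OF sq sq]]] by simp
  have S_axis: "(S *v axis j 1) $ i = S $ i $ j" for i j
    by (simp add: matrix_vector_mult_basis column_def)
  have "expectation (\<lambda>w. X w $ i * X w $ j) = S $ i $ j" for i j
  proof -
    have diag: "expectation (\<lambda>w. X w $ k * X w $ k) = S $ k $ k" for k
      using mom(4)[of "axis k 1"] by (simp add: S_axis inner_axis' power2_eq_square)
    have "S $ i $ i + S $ j $ j + 2 * S $ i $ j = expectation (\<lambda>w. (X w $ i + X w $ j)\<^sup>2)"
    proof -
      have "S $ j $ i = S $ i $ j" using sym by (metis transpose_def vec_lambda_beta)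
      then show ?thesis
        using mom(4)[of "axis i 1 + axis j 1"]
        by (simp add: inner_add_left inner_add_right matrix_vector_right_distrib S_axis inner_axis')
    qed
    also have "\<dots> = expectation (\<lambda>w. X w $ i * X w $ i + X w $ j * X w $ j + 2 * (X w $ i * X w $ j))"
      by (intro Bochner_Integration.integral_cong) (auto simp: power2_eq_square algebra_simps)
    also have "\<dots> = S $ i $ i + S $ j $ j + 2 * expectation (\<lambda>w. X w $ i * X w $ j)"
      using io by (simp add: diag)
    finally show ?thesis by simp
  qed
  then show "expectation (\<lambda>w. outer (X w) (X w)) = S"
    by (simp add: vec_eq_iff integral_mat_nth integrable_outer sq)
qed

lemma (in prob_space) centred_with_cov_linear_image:
  assumes "centred_with_cov M X S" and Y: "\<And>w. w \<in> space M \<Longrightarrow> Y w = U *v X w"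
  shows "centred_with_cov M Y (U ** S ** transpose U)"
  unfolding centred_with_cov_def
proof (intro conjI)
  have X: "square_integrable_vec M X" "expectation X = 0" "expectation (\<lambda>w. outer (X w) (X w)) = S"
    using assms(1) by (auto simp: centred_with_cov_def)
  have l: "bounded_linear ((*v) U)" by simp
  show "square_integrable_vec M Y"
    using square_integrable_vec_bounded_linear[OF X(1) l] Y square_integrable_vec_cong[of M Y] by simp
  have "expectation Y = expectation (\<lambda>w. U *v X w)"
    using Y by (intro Bochner_Integration.integral_cong) auto
  then show "expectation Y = 0"
    using integral_bounded_linear[OF l integrable_if_square_integrable_vec[OF X(1)]] X(2) by simp
  have "expectation (\<lambda>w. outer (Y w) (Y w)) = expectation (\<lambda>w. U ** outer (X w) (X w) ** transpose U)"
    using Y by (intro Bochner_Integration.integral_cong) (auto simp: outer_matrix_vector_mult)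
  then show "expectation (\<lambda>w. outer (Y w) (Y w)) = U ** S ** transpose U"
    using integral_bounded_linear[OF bounded_linear_matrix_mult_both integrable_outer[OF X(1) X(1)]]
    by (simp add: X(3))
qed

section \<open>Sigma-algebras generated by families of independent sources\<close>

lemma Int_stable_generated_events: "Int_stable (generated_events M X)"
proof (rule Int_stableI)
  fix a b assume "a \<in> generated_events M X" "b \<in> generated_events M X"
  then obtain S T where "a = X -` S \<inter> space M" "b = X -` T \<inter> space M" "S \<in> sets borel" "T \<in> sets borel"
    by (auto simp: generated_events_def)
  then have "a \<inter> b = X -` (S \<inter> T) \<inter> space M" "S \<inter> T \<in> sets borel" by auto
  then show "a \<inter> b \<in> generated_events M X" unfolding generated_events_def by blast
qed

lemma borel_measurable_sigma_generated_events:
  fixes X :: "'w \<Rightarrow> real ^ 'n"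
  assumes "generated_events M X \<subseteq> \<A>" "\<A> \<subseteq> Pow (space M)"
  shows "X \<in> borel_measurable (sigma (space M) \<A>)"
proof (rule measurableI)
  fix S :: "(real ^ 'n) set" assume "S \<in> sets borel"
  then have "X -` S \<inter> space M \<in> \<A>" using assms by (auto simp: generated_events_def)
  then show "X -` S \<inter> space (sigma (space M) \<A>) \<in> sets (sigma (space M) \<A>)"
    using assms(2) by (simp add: space_measure_of_conv)
qed simp

lemma (in prob_space) subalgebra_sigma_sources:
  assumes "\<And>s. E s \<subseteq> events"
  shows "subalgebra M (sigma (space M) (\<Union>s\<in>I. E s))"
proof -
  have "(\<Union>s\<in>I. E s) \<subseteq> events" using assms by auto
  then show ?thesis
    using sets.sigma_sets_subset[of "\<Union>s\<in>I. E s" M] sets.space_closed[of M]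
    by (simp add: subalgebra_def sets_measure_of_conv space_measure_of_conv)
qed

text \<open>
  Everything computed from one group of sources is independent of everything computed from a
  disjoint group. With past and present sources as the groups this separates the current state
  from the current noise; with single noise processes it makes the processes uncorrelated.
\<close>

lemma (in prob_space) indep_set_sigma_disjoint_sources:
  assumes indep: "indep_sets E UNIV" and stable: "\<And>s. Int_stable (E s)" and "I \<inter> J = {}"
  shows "indep_set (sets (sigma (space M) (\<Union>s\<in>I. E s))) (sets (sigma (space M) (\<Union>s\<in>J. E s)))"
proof -
  have ev: "E s \<subseteq> events" for s using indep by (auto simp: indep_sets_def)
  have pow: "(\<Union>s\<in>A. E s) \<subseteq> Pow (space M)" for A
    using ev sets.space_closed[of M] by blast
  have "indep_sets (\<lambda>b. sigma_sets (space M) (\<Union>s\<in>case_bool I J b. E s)) UNIV"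
    using assms(3)
    by (intro indep_sets_collect_sigma[of E] indep_sets_mono_index[OF _ indep] stable)
      (auto simp: disjoint_family_on_def split: bool.splits)
  then show ?thesis
    unfolding indep_set_def
    by (rule indep_sets_cong[OF refl, THEN iffD1, rotated]) (simp add: pow split: bool.split)
qed

section \<open>Stacking uncorrelated noise\<close>

lemma borel_measurable_block_vec:
  assumes "X \<in> borel_measurable F" "Y \<in> borel_measurable F"
  shows "(\<lambda>w. block_vec (X w) (Y w)) \<in> borel_measurable F"
  by (subst block_vec_split)
    (intro borel_measurable_add
       borel_measurable_continuous_on[OF linear_continuous_on[OF bounded_linear_block_vec_left] assms(1)]
       borel_measurable_continuous_on[OF linear_continuous_on[OF bounded_linear_block_vec_right] assms(2)])

lemma bounded_linear_block_projections:
  "bounded_linear (\<lambda>v :: real ^ ('n::finite + 'm::finite). \<chi> i. v $ Inl i)"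
  "bounded_linear (\<lambda>v :: real ^ ('n::finite + 'm::finite). \<chi> i. v $ Inr i)"
  by (rule linear_linear[THEN iffD2], simp add: linear_iff vec_eq_iff)+

lemma borel_measurable_block_vecD:
  assumes "(\<lambda>w. block_vec (X w) (Y w)) \<in> borel_measurable F"
  shows "X \<in> borel_measurable F" "Y \<in> borel_measurable F"
  using borel_measurable_continuous_on[OF linear_continuous_on[OF bounded_linear_block_projections(1)] assms]
    borel_measurable_continuous_on[OF linear_continuous_on[OF bounded_linear_block_projections(2)] assms]
  by (simp_all add: vec_lambda_eta)

lemma square_integrable_vec_block_vecD:
  assumes "square_integrable_vec M (\<lambda>w. block_vec (X w) (Y w))"
  shows "square_integrable_vec M X" "square_integrable_vec M Y"
  using square_integrable_vec_bounded_linear[OF assms bounded_linear_block_projections(1)]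
    square_integrable_vec_bounded_linear[OF assms bounded_linear_block_projections(2)]
  by (simp_all add: vec_lambda_eta)

lemma (in prob_space) centred_with_cov_block_vec:
  assumes alg: "subalgebra M F" "subalgebra M G" "indep_set (sets F) (sets G)"
    and X: "X \<in> borel_measurable F" "centred_with_cov M X S"
    and Y: "Y \<in> borel_measurable G" "centred_with_cov M Y T"
  shows "centred_with_cov M (\<lambda>w. block_vec (X w) (Y w)) (block_mat S 0 0 T)"
proof -
  have x: "square_integrable_vec M X" "expectation X = 0" "expectation (\<lambda>w. outer (X w) (X w)) = S"
    and y: "square_integrable_vec M Y" "expectation Y = 0" "expectation (\<lambda>w. outer (Y w) (Y w)) = T"
    using X Y by (auto simp: centred_with_cov_def)
  have xy: "expectation (\<lambda>w. outer (X w) (Y w)) = 0"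
    using expectation_outer_indep[OF alg X(1) x(1) Y(1) y(1)] x(2) by simp
  have "expectation (\<lambda>w. outer (Y w) (X w)) = expectation (\<lambda>w. transpose (outer (X w) (Y w)))"
    by (simp add: transpose_outer)
  also have "\<dots> = 0"
    using integral_bounded_linear[OF bounded_linear_transpose integrable_outer[OF x(1) y(1)]] xy
    by (simp add: transpose_def vec_eq_iff)
  finally have yx: "expectation (\<lambda>w. outer (Y w) (X w)) = 0" .
  have "block_vec (0 :: real ^ 'b) (0 :: real ^ 'c) = 0"
    by (rule block_vec_eqI) simp_all
  then show ?thesis
    unfolding centred_with_cov_def
    by (simp add: square_integrable_vec_block_vec integral_block_vec integrable_if_square_integrable_vec
        integral_outer_block_vec x y xy yx)
qed

section \<open>The closed loop as a noise-driven recursion\<close>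

text \<open>
  All noise acting in one step is stacked into the vector of \<open>\<xi>\<close>, \<open>\<epsilon>u\<close>, \<open>\<omega>\<close>, \<open>\<epsilon>y\<close>, \<open>\<eta>\<close>, in this order;
  \<open>noise_gain C L K D k x xh\<close> is the response of the stacked state to its \<open>k\<close>-th coordinate. The
  additive noises respond with constant columns, the multiplicative ones (second and fourth block)
  with vectors that are linear in the estimate and in the state.
\<close>

definition noise_gain ::
  "('c \<Rightarrow> real ^ 'm ^ 'n) \<Rightarrow> real ^ 'n ^ 'm \<Rightarrow> real ^ 'r ^ 'n \<Rightarrow> ('d \<Rightarrow> real ^ 'n ^ 'r) \<Rightarrow>
   'n + ('c + ('r + ('d + 'n))) \<Rightarrow> real ^ 'n \<Rightarrow> real ^ 'n \<Rightarrow> real ^ ('n + 'n)" where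
  "noise_gain C L K D k x xh = (case k of
     Inl i \<Rightarrow> block_vec (column i (mat 1)) 0
   | Inr (Inl i) \<Rightarrow> block_vec (- (C i ** L) *v xh) 0
   | Inr (Inr (Inl i)) \<Rightarrow> block_vec 0 (column i K)
   | Inr (Inr (Inr (Inl i))) \<Rightarrow> block_vec 0 ((K ** D i) *v x)
   | Inr (Inr (Inr (Inr i))) \<Rightarrow> block_vec 0 (column i (mat 1)))"

lemma noise_index_cases:
  assumes "\<And>i. P (Inl i)" "\<And>i. P (Inr (Inl i))" "\<And>i. P (Inr (Inr (Inl i)))"
    "\<And>i. P (Inr (Inr (Inr (Inl i))))" "\<And>i. P (Inr (Inr (Inr (Inr i))))"
  shows "P k"
proof (cases k)
  case 1: (Inr k1)
  show ?thesis
  proof (cases k1)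
    case 2: (Inr k2)
    show ?thesis
    proof (cases k2)
      case 3: (Inr k3)
      show ?thesis
        using assms(4,5) by (cases k3) (simp_all add: 1 2 3)
    qed (simp add: assms(3) 1 2)
  qed (simp add: assms(2) 1)
qed (simp add: assms(1))

lemma sum_scaleR_block_vec:
  "(\<Sum>i\<in>I. c i *\<^sub>R block_vec (a i) (b i)) = block_vec (\<Sum>i\<in>I. c i *\<^sub>R a i) (\<Sum>i\<in>I. c i *\<^sub>R b i)"
  by (rule block_vec_eqI) simp_all

lemma block_vec_add: "block_vec a b + block_vec a' b' = block_vec (a + a') (b + b')"
  by (rule block_vec_eqI) simp_all

lemma matrix_vector_mult_sum: "(A :: real ^ 'n ^ 'm) *v (\<Sum>i\<in>I. f i) = (\<Sum>i\<in>I. A *v f i)"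
  by (rule linear_sum[OF matrix_vector_mul_linear])

text \<open>
  The innovation \<open>y - H *v xh\<close> contains the state itself, which puts \<open>K ** H\<close> into the
  lower left block of the closed-loop matrix and subtracts it in the lower right one, while the
  feedback \<open>u\<close> subtracts \<open>B ** L\<close> from both blocks that act on the estimate.
\<close>

lemma closed_loop_step:
  fixes A :: "real ^ 'n ^ 'n" and B :: "real ^ 'm ^ 'n" and H :: "real ^ 'n ^ 'r"
    and C :: "'c::finite \<Rightarrow> real ^ 'm ^ 'n" and D :: "'d::finite \<Rightarrow> real ^ 'n ^ 'r"
  assumes u: "u = - (L *v xh)"
    and y: "y = H *v x + \<omega> + (\<Sum>i\<in>UNIV. \<epsilon>y $ i *\<^sub>R (D i *v x))"
    and x': "x' = A *v x + B *v u + \<xi> + (\<Sum>i\<in>UNIV. \<epsilon>u $ i *\<^sub>R (C i *v u))"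
    and xh': "xh' = A *v xh + B *v u + K *v (y - H *v xh) + \<eta>"
  shows "block_vec x' xh' = closed_loop_mat A B H L K *v block_vec x xh
    + (\<Sum>k\<in>UNIV. block_vec \<xi> (block_vec \<epsilon>u (block_vec \<omega> (block_vec \<epsilon>y \<eta>))) $ k
         *\<^sub>R noise_gain C L K D k x xh)"
proof -
  have neg: "(- S) *v v = - (S *v v)" for S :: "real ^ 'k ^ 'l" and v
    by (simp add: vec_eq_iff matrix_vector_mult_def sum_negf)
  have neg2: "S *v (- v) = - (S *v v)" for S :: "real ^ 'k ^ 'l" and v
    by (simp add: vec_eq_iff matrix_vector_mult_def sum_negf)
  have n: "(\<Sum>k\<in>UNIV. block_vec \<xi> (block_vec \<epsilon>u (block_vec \<omega> (block_vec \<epsilon>y \<eta>))) $ k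
         *\<^sub>R noise_gain C L K D k x xh)
    = block_vec (\<xi> - (\<Sum>i\<in>UNIV. \<epsilon>u $ i *\<^sub>R (C i *v (L *v xh))))
        (K *v \<omega> + (\<Sum>i\<in>UNIV. \<epsilon>y $ i *\<^sub>R (K *v (D i *v x))) + \<eta>)"
    by (simp add: sum_UNIV_Plus noise_gain_def sum_scaleR_block_vec block_vec_add
      matrix_vector_mult_columns neg sum_negf matrix_vector_mul_assoc add_ac)
  show ?thesis
    unfolding n closed_loop_mat_def block_mat_mult_vec block_vec_add u y x' xh'
    by (rule arg_cong2[where f = block_vec])
      (simp_all add: neg neg2 matrix_vector_mult_add_rdistrib matrix_vector_mult_diff_rdistrib
        matrix_vector_right_distrib matrix_vector_mult_diff_distrib matrix_vector_mult_sum
        matrix_vector_mult_scaleR matrix_vector_mul_assoc sum_negf)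
qed

lemma scaleR_block_mat: "c *\<^sub>R block_mat S T U V = block_mat (c *\<^sub>R S) (c *\<^sub>R T) (c *\<^sub>R U) (c *\<^sub>R V)"
  by (rule block_vec_eqI; rule block_vec_eqI) simp_all

text \<open>
  The covariance of the stacked noise is block diagonal, so gains of different noise processes
  never meet. Additive noise contributes its transformed covariance; multiplicative noise, having
  identity covariance, contributes the uncentred second moment of the vector that it multiplies.
\<close>

lemma (in prob_space) noise_gain_second_moments:
  fixes C :: "'c::finite \<Rightarrow> real ^ 'm ^ 'n" and D :: "'d::finite \<Rightarrow> real ^ 'n ^ 'r"
    and L :: "real ^ 'n ^ 'm" and K :: "real ^ 'r ^ 'n" and x xh :: "'a \<Rightarrow> real ^ 'n"
  assumes x: "square_integrable_vec M x" and xh: "square_integrable_vec M xh"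
  defines "g \<equiv> \<lambda>k w. noise_gain C L K D k (x w) (xh w)"
  shows "(\<Sum>k\<in>UNIV. \<Sum>l\<in>UNIV.
      block_mat \<Omega>\<xi> 0 0 (block_mat (mat 1) 0 0 (block_mat \<Omega>\<omega> 0 0 (block_mat (mat 1) 0 0 \<Omega>\<eta>))) $ k $ l
        *\<^sub>R expectation (\<lambda>w. outer (g k w) (g l w)))
    = block_mat
        (\<Omega>\<xi> + (\<Sum>i\<in>UNIV. C i ** L ** expectation (\<lambda>w. outer (xh w) (xh w)) ** transpose L ** transpose (C i)))
        0 0
        (\<Omega>\<eta> + K ** \<Omega>\<omega> ** transpose K
          + (\<Sum>i\<in>UNIV. K ** D i ** expectation (\<lambda>w. outer (x w) (x w)) ** transpose (D i) ** transpose K))"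
proof -
  have lin: "expectation (\<lambda>w. outer (S *v z w) (S *v z w)) = S ** expectation (\<lambda>w. outer (z w) (z w)) ** transpose S"
    if "square_integrable_vec M z" for S :: "real ^ 'n ^ 'n" and z
    using integral_bounded_linear[OF bounded_linear_matrix_mult_both integrable_outer[OF that that]]
    by (simp add: outer_matrix_vector_mult)
  have neg: "(- S) ** T ** transpose (- S) = S ** T ** transpose S" for S :: "real ^ 'k ^ 'l" and T
    by (simp add: vec_eq_iff matrix_matrix_mult_def transpose_def sum_negf)
  have multiplicative: "expectation (\<lambda>w. outer (block_vec ((- (C i ** L)) *v xh w) (0 :: real ^ 'n)) (block_vec ((- (C i ** L)) *v xh w) (0 :: real ^ 'n)))
      = block_mat (C i ** L ** expectation (\<lambda>w. outer (xh w) (xh w)) ** transpose L ** transpose (C i)) 0 0 0"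
    "expectation (\<lambda>w. outer (block_vec (0 :: real ^ 'n) ((K ** D j) *v x w)) (block_vec (0 :: real ^ 'n) ((K ** D j) *v x w)))
      = block_mat 0 0 0 (K ** D j ** expectation (\<lambda>w. outer (x w) (x w)) ** transpose (D j) ** transpose K)" for i j
    by (simp_all add: integral_outer_block_vec square_integrable_vec_const
        square_integrable_vec_bounded_linear[OF x] square_integrable_vec_bounded_linear[OF xh] lin x xh neg
        matrix_transpose_mul matrix_mul_assoc)
  show ?thesis
    unfolding g_def
    by (simp add: sum_UNIV_Plus noise_gain_def sum_mat_1_scaleR multiplicative[unfolded outer_block_vec outer_zero]
        prob_space outer_block_vec block_mat_zero transpose_mat
        scaleR_block_mat sum_block_mat block_mat_add outer_sum_scaleR_columns add_ac)
qed

section \<open>Mean and covariance recursions\<close>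

theorem lemma2:
  fixes M :: "'w measure" and N :: nat
    and A :: "nat \<Rightarrow> real ^ 'n ^ 'n" and B :: "nat \<Rightarrow> real ^ 'm ^ 'n" and H :: "nat \<Rightarrow> real ^ 'n ^ 'r"
    and C :: "'c::finite \<Rightarrow> real ^ 'm ^ 'n" and D :: "'d::finite \<Rightarrow> real ^ 'n ^ 'r"
    and \<sigma>u :: "'c \<Rightarrow> real" and \<sigma>x :: "'d \<Rightarrow> real"
    and F :: "nat \<Rightarrow> 'c \<Rightarrow> real ^ 'm ^ 'm" and G :: "nat \<Rightarrow> 'd \<Rightarrow> real ^ 'n ^ 'n"
    and x xh :: "nat \<Rightarrow> 'w \<Rightarrow> real ^ 'n" and u :: "nat \<Rightarrow> 'w \<Rightarrow> real ^ 'm" and y :: "nat \<Rightarrow> 'w \<Rightarrow> real ^ 'r"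
    and \<alpha> :: "nat \<Rightarrow> 'w \<Rightarrow> real ^ 'p" and \<beta> :: "nat \<Rightarrow> 'w \<Rightarrow> real ^ 'q"
    and \<xi> \<eta> :: "nat \<Rightarrow> 'w \<Rightarrow> real ^ 'n" and \<omega> :: "nat \<Rightarrow> 'w \<Rightarrow> real ^ 'r"
    and \<epsilon>u :: "nat \<Rightarrow> 'w \<Rightarrow> real ^ 'c" and \<epsilon>y :: "nat \<Rightarrow> 'w \<Rightarrow> real ^ 'd"
    and \<Sigma>\<xi> :: "real ^ 'p ^ 'n" and \<Sigma>\<omega> :: "real ^ 'q ^ 'r"
    and \<Omega>\<xi> \<Omega>\<eta> \<Omega>0 :: "real ^ 'n ^ 'n" and \<Omega>\<omega> :: "real ^ 'r ^ 'r"
    and QN Q :: "real ^ 'n ^ 'n" and R :: "real ^ 'm ^ 'm" and J :: real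
    and L :: "nat \<Rightarrow> real ^ 'n ^ 'm" and K :: "nat \<Rightarrow> real ^ 'r ^ 'n"
  assumes prob: "prob_space M"
    and C_form: "\<And>t i. t < N \<Longrightarrow> C i = \<sigma>u i *\<^sub>R (B t ** F t i)"
    and D_form: "\<And>t i. t < N \<Longrightarrow> D i = \<sigma>x i *\<^sub>R (H t ** G t i)"
    \<comment> \<open>noise processes\<close>
    and \<alpha>_noise: "white_gaussian_noise M \<alpha> (mat 1)"
    and \<beta>_noise: "white_gaussian_noise M \<beta> (mat 1)"
    and \<xi>_eq: "\<And>t w. w \<in> space M \<Longrightarrow> \<xi> t w = \<Sigma>\<xi> *v \<alpha> t w"
    and \<omega>_eq: "\<And>t w. w \<in> space M \<Longrightarrow> \<omega> t w = \<Sigma>\<omega> *v \<beta> t w"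
    and \<Omega>\<xi>_eq: "\<Omega>\<xi> = \<Sigma>\<xi> ** transpose \<Sigma>\<xi>"
    and \<Omega>\<omega>_eq: "\<Omega>\<omega> = \<Sigma>\<omega> ** transpose \<Sigma>\<omega>"
    and \<Omega>\<omega>_pd: "pos_def \<Omega>\<omega>"
    and \<epsilon>u_noise: "white_gaussian_noise M \<epsilon>u (mat 1)"
    and \<epsilon>y_noise: "white_gaussian_noise M \<epsilon>y (mat 1)"
    and \<Omega>\<eta>_psd: "pos_semidef \<Omega>\<eta>"
    and \<eta>_noise: "white_gaussian_noise M \<eta> \<Omega>\<eta>"
    and indep: "independent_sources M (x 0) \<xi> \<omega> \<epsilon>u \<epsilon>y \<eta>"
    \<comment> \<open>initial state\<close>
    and x0_sq: "square_integrable_vec M (x 0)"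
    and x0_cov: "cov M (x 0) (x 0) = \<Omega>0"
    \<comment> \<open>optimal control problem\<close>
    and QN_psd: "pos_semidef QN" and Q_psd: "pos_semidef Q" and R_pd: "pos_def R"
    and J_eq: "J = lqs_cost M N QN Q R x u"
    and state_eq: "\<And>t w. t < N \<Longrightarrow> w \<in> space M \<Longrightarrow>
      x (Suc t) w = A t *v x t w + B t *v u t w + \<xi> t w
        + (\<Sum>i\<in>UNIV. \<epsilon>u t w $ i *\<^sub>R (C i *v u t w))"
    and output_eq: "\<And>t w. t < N \<Longrightarrow> w \<in> space M \<Longrightarrow>
      y t w = H t *v x t w + \<omega> t w + (\<Sum>i\<in>UNIV. \<epsilon>y t w $ i *\<^sub>R (D i *v x t w))"
    \<comment> \<open>approximate solution\<close>
    and control_law: "\<And>t w. t < N \<Longrightarrow> w \<in> space M \<Longrightarrow> u t w = - (L t *v xh t w)"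
    and estimator_init: "\<And>w. w \<in> space M \<Longrightarrow> xh 0 w = integral\<^sup>L M (x 0)"
    and estimator_eq: "\<And>t w. t < N \<Longrightarrow> w \<in> space M \<Longrightarrow>
      xh (Suc t) w = A t *v xh t w + B t *v u t w + K t *v (y t w - H t *v xh t w) + \<eta> t w"
    and gains: "alternating_gains
      (control_step N A B H C D QN Q R)
      (filter_step N A B H C D \<Omega>\<xi> \<Omega>\<omega> \<Omega>\<eta> \<Omega>0 (integral\<^sup>L M (x 0))) L K"
  shows "(\<forall>t\<le>N. square_integrable_vec M (x t) \<and> square_integrable_vec M (xh t))
    \<and> integral\<^sup>L M (xh 0) = integral\<^sup>L M (x 0)
    \<and> joint_cov M (x 0) (xh 0) = block_mat \<Omega>0 0 0 0
    \<and> (\<forall>t<N. block_vec (integral\<^sup>L M (x (Suc t))) (integral\<^sup>L M (xh (Suc t)))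
      = closed_loop_mat (A t) (B t) (H t) (L t) (K t)
          *v block_vec (integral\<^sup>L M (x t)) (integral\<^sup>L M (xh t)))
    \<and> (\<forall>t<N. joint_cov M (x (Suc t)) (xh (Suc t))
      = closed_loop_mat (A t) (B t) (H t) (L t) (K t) ** joint_cov M (x t) (xh t)
          ** transpose (closed_loop_mat (A t) (B t) (H t) (L t) (K t))
        + block_mat \<Omega>\<xi> 0 0 (\<Omega>\<eta> + K t ** \<Omega>\<omega> ** transpose (K t))
        + block_mat
            (\<Sum>i\<in>UNIV. C i ** L t
               ** (cov M (xh t) (xh t) + outer (integral\<^sup>L M (xh t)) (integral\<^sup>L M (xh t)))
               ** transpose (L t) ** transpose (C i))
            0
            0
            (\<Sum>i\<in>UNIV. K t ** D i
               ** (cov M (x t) (x t) + outer (integral\<^sup>L M (x t)) (integral\<^sup>L M (x t)))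
               ** transpose (D i) ** transpose (K t)))"
proof -
  interpret prob_space M by (fact prob)
  define E where "E s = (case s of
          InitialState \<Rightarrow> generated_events M (x 0)
        | Xi t \<Rightarrow> generated_events M (\<xi> t)
        | Omega t \<Rightarrow> generated_events M (\<omega> t)
        | EpsU t \<Rightarrow> generated_events M (\<epsilon>u t)
        | EpsY t \<Rightarrow> generated_events M (\<epsilon>y t)
        | Eta t \<Rightarrow> generated_events M (\<eta> t))" for s
  have indep_E: "indep_sets E UNIV"
    using indep by (simp add: independent_sources_def E_def[abs_def])
  have stable: "Int_stable (E s)" for s
    by (cases s) (simp_all add: E_def Int_stable_generated_events)
  have E_events: "E s \<subseteq> events" for s
    using indep_E by (auto simp: indep_sets_def)
  define \<S> where "\<S> I = sigma (space M) (\<Union>s\<in>I. E s)" for I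
  have sub: "subalgebra M (\<S> I)" for I
    unfolding \<S>_def by (rule subalgebra_sigma_sources[OF E_events])
  have indep_\<S>: "indep_set (sets (\<S> I)) (sets (\<S> I'))" if "I \<inter> I' = {}" for I I'
    unfolding \<S>_def by (rule indep_set_sigma_disjoint_sources[OF indep_E stable that])
  have space_\<S>: "space (\<S> I) = space M" for I
    using sub by (auto simp: subalgebra_def)
  have pow: "(\<Union>s\<in>I. E s) \<subseteq> Pow (space M)" for I
    using E_events sets.space_closed[of M] by blast
  have mono: "f \<in> borel_measurable (\<S> I')" if "f \<in> borel_measurable (\<S> I)" "I \<subseteq> I'"
    for f :: "'w \<Rightarrow> real ^ 'k" and I I'
  proof (rule measurable_from_subalg[OF _ that(1)])
    have "(\<Union>s\<in>I. E s) \<subseteq> (\<Union>s\<in>I'. E s)" using that(2) by auto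
    then show "subalgebra (\<S> I') (\<S> I)"
      using pow[of I] pow[of I'] unfolding subalgebra_def space_\<S>
      by (simp add: \<S>_def sets_measure_of_conv sigma_sets_mono')
  qed
  have meas: "f \<in> borel_measurable (\<S> I)" if "generated_events M f = E s" "s \<in> I"
    for f :: "'w \<Rightarrow> real ^ 'k" and s I
    unfolding \<S>_def using that by (intro borel_measurable_sigma_generated_events pow) auto

  \<comment> \<open>The state at time \<open>t\<close> depends only on the initial state and on noise drawn strictly before \<open>t\<close>.\<close>
  define past where "past t = insert InitialState (\<Union>s<t. {Xi s, EpsU s, Omega s, EpsY s, Eta s})" for t
  define now where "now t = {Xi t, EpsU t, Omega t, EpsY t, Eta t}" for t
  have past_now: "now t \<inter> past t = {}" for t
    by (auto simp: past_def now_def)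
  have past_Suc: "past (Suc t) = past t \<union> now t" for t
    by (auto simp: past_def now_def lessThan_Suc)

  define \<nu> where
    "\<nu> t w = block_vec (\<xi> t w) (block_vec (\<epsilon>u t w) (block_vec (\<omega> t w) (block_vec (\<epsilon>y t w) (\<eta> t w))))" for t w
  define S where
    "S = block_mat \<Omega>\<xi> 0 0 (block_mat (mat 1 :: real ^ 'c ^ 'c) 0 0
       (block_mat \<Omega>\<omega> 0 0 (block_mat (mat 1 :: real ^ 'd ^ 'd) 0 0 \<Omega>\<eta>)))"
  have \<nu>: "\<nu> t \<in> borel_measurable (\<S> (now t))" "centred_with_cov M (\<nu> t) S" for t
  proof -
    have gauss: "centred_with_cov M (X t) V"
      if "white_gaussian_noise M X V" "transpose V = V" for X :: "nat \<Rightarrow> 'w \<Rightarrow> real ^ 'k" and V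
      using that by (intro gaussian_vec_centred_with_cov) (auto simp: white_gaussian_noise_def)
    have \<xi>: "centred_with_cov M (\<xi> t) \<Omega>\<xi>" and \<omega>: "centred_with_cov M (\<omega> t) \<Omega>\<omega>"
      using centred_with_cov_linear_image[OF gauss[OF \<alpha>_noise] \<xi>_eq]
        centred_with_cov_linear_image[OF gauss[OF \<beta>_noise] \<omega>_eq]
      by (simp_all add: transpose_mat \<Omega>\<xi>_eq \<Omega>\<omega>_eq)
    have \<epsilon>u: "centred_with_cov M (\<epsilon>u t) (mat 1)" and \<epsilon>y: "centred_with_cov M (\<epsilon>y t) (mat 1)"
      and \<eta>: "centred_with_cov M (\<eta> t) \<Omega>\<eta>"
      using gauss[OF \<epsilon>u_noise] gauss[OF \<epsilon>y_noise] gauss[OF \<eta>_noise] \<Omega>\<eta>_psd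
      by (simp_all add: transpose_mat pos_semidef_def)
    have m: "Xi t \<in> I \<Longrightarrow> \<xi> t \<in> borel_measurable (\<S> I)" "Omega t \<in> I \<Longrightarrow> \<omega> t \<in> borel_measurable (\<S> I)"
      "EpsU t \<in> I \<Longrightarrow> \<epsilon>u t \<in> borel_measurable (\<S> I)" "EpsY t \<in> I \<Longrightarrow> \<epsilon>y t \<in> borel_measurable (\<S> I)"
      "Eta t \<in> I \<Longrightarrow> \<eta> t \<in> borel_measurable (\<S> I)" for I
      by (erule meas[rotated], simp add: E_def)+
    show "\<nu> t \<in> borel_measurable (\<S> (now t))"
      unfolding \<nu>_def[abs_def] by (intro borel_measurable_block_vec m) (simp_all add: now_def)
    \<comment> \<open>Peeling off one process at a time, each is independent of the stack of the remaining ones.\<close>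
    show "centred_with_cov M (\<nu> t) S"
      unfolding \<nu>_def[abs_def] S_def
      by (rule centred_with_cov_block_vec[where F = "\<S> {Xi t}" and G = "\<S> {EpsU t, Omega t, EpsY t, Eta t}"]
          centred_with_cov_block_vec[where F = "\<S> {EpsU t}" and G = "\<S> {Omega t, EpsY t, Eta t}"]
          centred_with_cov_block_vec[where F = "\<S> {Omega t}" and G = "\<S> {EpsY t, Eta t}"]
          centred_with_cov_block_vec[where F = "\<S> {EpsY t}" and G = "\<S> {Eta t}"]
          sub indep_\<S> m borel_measurable_block_vec \<xi> \<omega> \<epsilon>u \<epsilon>y \<eta> | simp)+
  qed

  define s where "s t w = block_vec (x t w) (xh t w)" for t w
  define T where "T t = closed_loop_mat (A t) (B t) (H t) (L t) (K t)" for t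
  define g where "g t k w = noise_gain C (L t) (K t) D k (x t w) (xh t w)" for t k w
  have step: "s (Suc t) w = T t *v s t w + (\<Sum>k\<in>UNIV. \<nu> t w $ k *\<^sub>R g t k w)"
    if "t < N" "w \<in> space M" for t w
    unfolding s_def T_def \<nu>_def g_def
    using control_law[OF that] output_eq[OF that] state_eq[OF that] estimator_eq[OF that]
    by (rule closed_loop_step)
  have g: "g t k \<in> borel_measurable (\<S> I)" "square_integrable_vec M (g t k)"
    if "s t \<in> borel_measurable (\<S> I)" "square_integrable_vec M (s t)" for t k I
  proof -
    have x: "x t \<in> borel_measurable (\<S> I)" "xh t \<in> borel_measurable (\<S> I)"
      "square_integrable_vec M (x t)" "square_integrable_vec M (xh t)"
      using borel_measurable_block_vecD[of "x t" "xh t"] square_integrable_vec_block_vecD[of M "x t" "xh t"] that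
      by (simp_all add: s_def[abs_def])
    have mv: "(\<lambda>w. U *v f w) \<in> borel_measurable (\<S> I)" if "f \<in> borel_measurable (\<S> I)"
      for U :: "real ^ 'n ^ 'n" and f
      by (rule borel_measurable_continuous_on[OF linear_continuous_on that]) simp
    have mvs: "square_integrable_vec M (\<lambda>w. U *v f w)" if "square_integrable_vec M f"
      for U :: "real ^ 'n ^ 'n" and f
      by (rule square_integrable_vec_bounded_linear[OF that]) simp
    show "g t k \<in> borel_measurable (\<S> I)"
      unfolding g_def[abs_def]
      by (rule noise_index_cases[of _ k])
        (auto simp: noise_gain_def intro!: borel_measurable_block_vec mv x)
    show "square_integrable_vec M (g t k)"
      unfolding g_def[abs_def]
      by (rule noise_index_cases[of _ k])
        (auto simp: noise_gain_def
          intro!: square_integrable_vec_block_vec square_integrable_vec_const mvs x)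
  qed
  have driven: "square_integrable_vec M (s (Suc t))"
      "integral\<^sup>L M (s (Suc t)) = T t *v integral\<^sup>L M (s t)"
      "cov M (s (Suc t)) (s (Suc t)) = T t ** cov M (s t) (s t) ** transpose (T t)
        + (\<Sum>k\<in>UNIV. \<Sum>l\<in>UNIV. S $ k $ l *\<^sub>R expectation (\<lambda>w. outer (g t k w) (g t l w)))"
    if s: "s t \<in> borel_measurable (\<S> (past t))" "square_integrable_vec M (s t)" and t: "t < N" for t
  proof -
    have \<nu>t: "square_integrable_vec M (\<nu> t)" "expectation (\<nu> t) = 0"
      "expectation (\<lambda>w. outer (\<nu> t w) (\<nu> t w)) = S"
      using \<nu>(2)[of t] by (simp_all add: centred_with_cov_def)
    note * = noise_driven_step[OF sub sub indep_\<S>[OF past_now] \<nu>(1) \<nu>t(1,2) s g[OF s] step[OF t]]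
    show "square_integrable_vec M (s (Suc t))" by (rule *(1))
    show "integral\<^sup>L M (s (Suc t)) = T t *v integral\<^sup>L M (s t)" by (rule *(2))
    show "cov M (s (Suc t)) (s (Suc t)) = T t ** cov M (s t) (s t) ** transpose (T t)
        + (\<Sum>k\<in>UNIV. \<Sum>l\<in>UNIV. S $ k $ l *\<^sub>R expectation (\<lambda>w. outer (g t k w) (g t l w)))"
      using *(3) unfolding \<nu>t(3) .
  qed
  have xh0: "integral\<^sup>L M (xh 0) = integral\<^sup>L M (x 0)"
    using estimator_init Bochner_Integration.integral_cong[of M M "xh 0" "\<lambda>_. integral\<^sup>L M (x 0)"]
    by (simp add: prob_space)
  \<comment> \<open>Square integrability and dependence on the past alone are propagated together, since the
    former needs the independence that the latter provides.\<close>
  have s: "s t \<in> borel_measurable (\<S> (past t)) \<and> square_integrable_vec M (s t)" if "t \<le> N" for t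
    using that
  proof (induction t)
    case 0
    have "xh 0 \<in> borel_measurable (\<S> (past 0)) \<longleftrightarrow> (\<lambda>_. integral\<^sup>L M (x 0)) \<in> borel_measurable (\<S> (past 0))"
      by (rule measurable_cong) (simp add: space_\<S> estimator_init)
    moreover have "square_integrable_vec M (xh 0) \<longleftrightarrow> square_integrable_vec M (\<lambda>_. integral\<^sup>L M (x 0))"
      by (rule square_integrable_vec_cong) (rule estimator_init)
    moreover have "x 0 \<in> borel_measurable (\<S> (past 0))"
      by (rule meas[of _ InitialState]) (simp_all add: E_def past_def)
    ultimately show ?case
      unfolding s_def[abs_def]
      by (auto intro!: borel_measurable_block_vec square_integrable_vec_block_vec x0_sq square_integrable_vec_const)
  next
    case (Suc t)
    then have t: "t < N" and IH: "s t \<in> borel_measurable (\<S> (past t))" "square_integrable_vec M (s t)" by auto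
    have m: "s t \<in> borel_measurable (\<S> (past (Suc t)))" "\<nu> t \<in> borel_measurable (\<S> (past (Suc t)))"
      using IH(1) \<nu>(1)[of t] by (auto intro: mono simp: past_Suc)
    have Ts: "(\<lambda>w. T t *v s t w) \<in> borel_measurable (\<S> (past (Suc t)))"
      by (rule borel_measurable_continuous_on[OF linear_continuous_on m(1)]) simp
    have "(\<lambda>w. \<nu> t w $ k *\<^sub>R g t k w) \<in> borel_measurable (\<S> (past (Suc t)))" for k
      by (rule borel_measurable_scaleR[OF borel_measurable_vec_nth[OF m(2)] g(1)[OF m(1) IH(2)]])
    then have "(\<lambda>w. T t *v s t w + (\<Sum>k\<in>UNIV. \<nu> t w $ k *\<^sub>R g t k w)) \<in> borel_measurable (\<S> (past (Suc t)))"
      by (intro borel_measurable_add Ts borel_measurable_sum)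
    then have "s (Suc t) \<in> borel_measurable (\<S> (past (Suc t)))"
      using step[OF t] by (subst measurable_cong) (auto simp: space_\<S>)
    moreover have "square_integrable_vec M (s (Suc t))"
      by (rule driven(1)[OF IH t])
    ultimately show ?case by simp
  qed
  have sq: "square_integrable_vec M (x t)" "square_integrable_vec M (xh t)" if "t \<le> N" for t
    using s[OF that] square_integrable_vec_block_vecD[of M "x t" "xh t"] by (simp_all add: s_def[abs_def])
  have mean_s: "integral\<^sup>L M (s t) = block_vec (integral\<^sup>L M (x t)) (integral\<^sup>L M (xh t))" if "t \<le> N" for t
    unfolding s_def[abs_def]
    by (intro integral_block_vec integrable_if_square_integrable_vec sq that)
  have cov_s: "joint_cov M (x t) (xh t) = cov M (s t) (s t)" if "t \<le> N" for t
    unfolding s_def[abs_def] by (intro joint_cov_eq_cov_block_vec sq that)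
  have init: "joint_cov M (x 0) (xh 0) = block_mat \<Omega>0 0 0 0"
  proof -
    have "xh 0 w - integral\<^sup>L M (xh 0) = 0" if "w \<in> space M" for w
      using estimator_init[OF that] by (simp add: xh0)
    then have "cov M (x 0) (xh 0) = 0" "cov M (xh 0) (x 0) = 0" "cov M (xh 0) (xh 0) = 0"
      unfolding cov_def
      using Bochner_Integration.integral_cong[of M M "\<lambda>w. outer (x 0 w - integral\<^sup>L M (x 0)) (xh 0 w - integral\<^sup>L M (xh 0))" "\<lambda>_. 0"]
       Bochner_Integration.integral_cong[of M M "\<lambda>w. outer (xh 0 w - integral\<^sup>L M (xh 0)) (x 0 w - integral\<^sup>L M (x 0))" "\<lambda>_. 0"]
       Bochner_Integration.integral_cong[of M M "\<lambda>w. outer (xh 0 w - integral\<^sup>L M (xh 0)) (xh 0 w - integral\<^sup>L M (xh 0))" "\<lambda>_. 0"]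
      by simp_all
    then show ?thesis by (simp add: joint_cov_def x0_cov)
  qed
  have mean_step: "block_vec (integral\<^sup>L M (x (Suc t))) (integral\<^sup>L M (xh (Suc t)))
      = T t *v block_vec (integral\<^sup>L M (x t)) (integral\<^sup>L M (xh t))" if "t < N" for t
    using driven(2)[OF _ _ that] s[of t] that by (simp flip: mean_s)
  have cov_step: "joint_cov M (x (Suc t)) (xh (Suc t)) = T t ** joint_cov M (x t) (xh t) ** transpose (T t)
      + block_mat \<Omega>\<xi> 0 0 (\<Omega>\<eta> + K t ** \<Omega>\<omega> ** transpose (K t))
      + block_mat
            (\<Sum>i\<in>UNIV. C i ** L t
               ** (cov M (xh t) (xh t) + outer (integral\<^sup>L M (xh t)) (integral\<^sup>L M (xh t)))
               ** transpose (L t) ** transpose (C i))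
            0
            0
            (\<Sum>i\<in>UNIV. K t ** D i
               ** (cov M (x t) (x t) + outer (integral\<^sup>L M (x t)) (integral\<^sup>L M (x t)))
               ** transpose (D i) ** transpose (K t))" if "t < N" for t
  proof -
    have t: "t \<le> N" "Suc t \<le> N" using that by auto
    have "cov M (s (Suc t)) (s (Suc t)) = T t ** cov M (s t) (s t) ** transpose (T t)
      + (\<Sum>k\<in>UNIV. \<Sum>l\<in>UNIV. S $ k $ l *\<^sub>R expectation (\<lambda>w. outer (g t k w) (g t l w)))"
      using driven(3)[OF _ _ that] s[OF t(1)] by blast
    \<comment> \<open>The second moments of state and estimate become covariances plus outer products of means.\<close>
    then show ?thesis
      unfolding S_def g_def noise_gain_second_moments[OF sq[OF t(1)]] cov_s[OF t(1)] cov_s[OF t(2)]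
      by (simp add: block_mat_add integral_outer_eq_cov sq t add.assoc)
  qed
  show ?thesis
    using sq xh0 init mean_step cov_step by (auto simp: T_def)
qed

end
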